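(* Let $p\in[1,\infty)$. Assume: (i) for some $K\le H(\eta)$ (with $K>0$) there is a sequence of Borel maps $T_n:\Omega\to V_n$ with $T_n\#\mu=\mu_n$ and $\sup_{x\in\Omega}|T_n(x)-x|\le K\varepsilon_n$ for every $n\in\mathbb N$; (ii) $\eta$ is continuous at $0$, non-increasing, and $\eta(0)>0$; (iii) there is $D>0$ with $\frac1D\le\rho(x)\le D$ for all $x\in\Omega$. Additionally assume there exists $q>p$ such that $\aleph_\eta^q<+\infty$. Then there exists a constant $C>0$ such that, for every $n\in\mathbb N$ and every function $u:V_n\to\mathbb R$, $$\|u-\mathbb E_{\mu_n}u\|_{L^p(V_n;\mu_n)}\le C\left(\mathcal{GE}_n^p(u)\right)^{1/p}.$$
   Context: $\mathbb N=\{1,2,\dots\}$; $d\in\mathbb N$; $\Omega\subset\mathbb R^d$ is an open and bounded set with Lipschitz boundary (near each boundary point, in suitable orthonormal coordinates, $\Omega$ is the region on one side of the graph of a Lipschitz function). $\mu$ is a probability measure on $\Omega$ with continuous density $\rho:\Omega\to\mathbb R$ with respect to Lebesgue measure. For $n\in\mathbb N$, $V_n\subset\Omega$ is a finite set, $\mu_n$ is a probability measure on $V_n$ (also regarded as a measure on $\Omega$), $\mu_n(x):=\mu_n(\{x\})$. $(\varepsilon_n)_{n\in\mathbb N}$ is a sequence of positive reals with $\varepsilon_n\to0$ as $n\to\infty$. The kernel is a function $\eta:[0,\infty)\to[0,\infty)$, and $\eta_\varepsilon(r):=\varepsilon^{-d}\eta(r/\varepsilon)$ for $\varepsilon>0$.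 For $t\ge0$, $\aleph_\eta^t:=\int_0^\infty\eta(r)r^{d+t-1}\,dr$. The push-forward is $T\#\mu(A):=\mu(T^{-1}(A))$. $\mathbb E_{\mu_n}u:=\sum_{x\in V_n}u(x)\mu_n(x)$. For $u:V_n\to\mathbb R$ and $p\ge1$, $$\|u\|_{L^p(V_n;\mu_n)}:=\Big(\sum_{x\in V_n}|u(x)|^p\mu_n(x)\Big)^{1/p},\qquad \mathcal{GE}_n^p(u):=\frac1{\varepsilon_n^p}\sum_{x\in V_n}\sum_{y\in V_n}\eta_{\varepsilon_n}(|x-y|)|u(x)-u(y)|^p\mu_n(x)\mu_n(y).$$ The constant $H(\eta)>0$ depends only on $\eta$: for $\eta$ satisfying (ii), fix constants $a>0$, $b\ge1$ such that $\eta(r)\ge a\cdot\mathbf 1_{br\le1}$ for all $r\ge0$ (where $\mathbf 1_P$ is $1$ if $P$ is true and $0$ otherwise); then $H(\eta):=\frac1{4b}$.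
   Formalization: The set Ω is additionally assumed to be connected; without this the inequality is false (e.g. Ω a union of two disjoint intervals with u the indicator of one), and it fails for every disconnected Ω under the stated hypotheses. *)

theory Defs
  imports "HOL-Probability.Probability"
begin

text \<open>
  Lipschitz boundary: near each boundary point, \<open>\<Omega>\<close> is the region on one side of the graph of a
  Lipschitz function. The orthonormal coordinate system is described by its last axis \<open>e\<close> alone:
  \<open>x\<close> has last coordinate \<open>x \<bullet> e\<close>, and its remaining coordinates are those of the orthogonal
  projection \<open>x - (x \<bullet> e) *\<^sub>R e\<close> onto the hyperplane on which \<open>g\<close> is defined.
\<close>

definition lipschitz_boundary :: "(real^'d) set \<Rightarrow> bool" where
  "lipschitz_boundary \<Omega> \<longleftrightarrow>
     (\<forall>z\<in>frontier \<Omega>. \<exists>r>0. \<exists>e. \<exists>g. \<exists>L.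
        norm e = 1 \<and> L-lipschitz_on {y. y \<bullet> e = 0} g \<and>
        \<Omega> \<inter> ball z r = {x \<in> ball z r. g (x - (x \<bullet> e) *\<^sub>R e) < x \<bullet> e})"

definition scaled_kernel :: "nat \<Rightarrow> (real \<Rightarrow> real) \<Rightarrow> real \<Rightarrow> real \<Rightarrow> real" where
  "scaled_kernel d \<eta> \<epsilon> r = \<eta> (r / \<epsilon>) / \<epsilon> ^ d"

definition kernel_moment :: "nat \<Rightarrow> (real \<Rightarrow> real) \<Rightarrow> real \<Rightarrow> ennreal" where
  "kernel_moment d \<eta> t =
     (\<integral>\<^sup>+r\<in>{0..}. ennreal (\<eta> r * r powr (real d + t - 1)) \<partial>lborel)"

text \<open>
  The constant \<open>H(\<eta>)\<close> depends on a choice of \<open>a\<close> and \<open>b\<close>; the predicate says that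
  \<open>H\<close> arises from some admissible choice.
\<close>

definition kernel_constant :: "(real \<Rightarrow> real) \<Rightarrow> real \<Rightarrow> bool" where
  "kernel_constant \<eta> H \<longleftrightarrow>
     (\<exists>a>0. \<exists>b\<ge>1. (\<forall>r\<ge>0. a * of_bool (b * r \<le> 1) \<le> \<eta> r) \<and> H = 1 / (4 * b))"

definition graph_mean :: "(real^'d) set \<Rightarrow> (real^'d) measure \<Rightarrow> (real^'d \<Rightarrow> real) \<Rightarrow> real" where
  "graph_mean V \<nu> u = (\<Sum>x\<in>V. u x * measure \<nu> {x})"

definition graph_Lp_norm ::
  "real \<Rightarrow> (real^'d) set \<Rightarrow> (real^'d) measure \<Rightarrow> (real^'d \<Rightarrow> real) \<Rightarrow> real" where
  "graph_Lp_norm p V \<nu> u = (\<Sum>x\<in>V. \<bar>u x\<bar> powr p * measure \<nu> {x}) powr (1 / p)"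

definition graph_energy ::
  "real \<Rightarrow> (real \<Rightarrow> real) \<Rightarrow> real \<Rightarrow> (real^'d) set \<Rightarrow> (real^'d) measure \<Rightarrow>
   (real^'d \<Rightarrow> real) \<Rightarrow> real" where
  "graph_energy p \<eta> \<epsilon> V \<nu> u =
     1 / \<epsilon> powr p *
       (\<Sum>x\<in>V. \<Sum>y\<in>V. scaled_kernel CARD('d) \<eta> \<epsilon> (norm (x - y)) *
          \<bar>u x - u y\<bar> powr p * measure \<nu> {x} * measure \<nu> {y})"

end

theory Submission
  imports Defs
begin

text \<open>
  The inequality on the graph is a discretisation of a nonlocal Poincare inequality on \<open>\<Omega>\<close>: with
  \<open>d\<close> the dimension, there is a constant \<open>c\<close> such that for all \<open>0 < \<delta> \<le> 1\<close> and all Borel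
  functions \<open>f\<close>, the integral of \<open>\<bar>f x - f y\<bar> powr p\<close> over \<open>\<Omega> \<times> \<Omega>\<close> is at most
  \<open>c * \<delta> powr - (p + d)\<close> times its integral over the pairs at distance at most \<open>\<delta>\<close>.

  On a convex set, a jump from \<open>x\<close> to \<open>y\<close> is split into \<open>N\<close> equal jumps along the segment.
  Convexity of the power costs \<open>N powr p\<close>, and the substitution in the increment costs \<open>N ^ d\<close>;
  with \<open>N\<close> of order \<open>1 / \<delta>\<close> this is the required factor (\<open>nonlocal_poincare_convex\<close>). A region
  just above a Lipschitz graph is the image of a convex cylinder under a Lipschitz shear, and a
  shear preserves Lebesgue measure, so the inequality carries over
  (\<open>nonlocal_poincare_graph_domain\<close>). Two overlapping open sets with the inequality can be glued
  by passing through a common point and averaging over the overlap (\<open>nonlocal_poincare_Un\<close>). The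
  closure of \<open>\<Omega>\<close> is compact and \<open>\<Omega>\<close> is connected, so finitely many balls and boundary regions
  cover \<open>\<Omega>\<close> and can be glued one after another (\<open>nonlocal_poincare_lipschitz_domain\<close>).

  For the graph, \<open>f = u \<circ> T\<^sub>n\<close> turns the sums over \<open>V\<^sub>n\<close> into integrals over \<open>\<Omega>\<close>, up to powers of
  the density bound \<open>D\<close>. Jumps shorter than \<open>\<epsilon>\<^sub>n / (2 b)\<close> are moved by \<open>T\<^sub>n\<close> to edges of length
  at most \<open>\<epsilon>\<^sub>n / b\<close>, because \<open>K \<le> 1 / (4 b)\<close>, and there the kernel is at least \<open>a\<close>
  (\<open>graph_poincare_of_nonlocal\<close>, \<open>near_sum_le_graph_energy\<close>). Jensen's inequality bounds the
  deviation of \<open>u\<close> from its mean by the double sum of its differences. The sequence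
  \<open>\<epsilon>\<close> converges, hence is bounded, which makes the constant uniform in \<open>n\<close>.
\<close>

section \<open>Convexity of powers\<close>

text \<open>
  The origin is included because increments of a function may vanish; there the inequality reduces
  to \<open>s powr p \<le> s\<close> for \<open>s\<close> in the unit interval.
\<close>

lemma convex_on_powr_nonneg:
  fixes p :: real
  assumes "p \<ge> 1"
  shows "convex_on {0..} (\<lambda>x. x powr p)"
proof (rule convex_onI)
  fix t x y :: real
  assume t: "0 < t" "t < 1" and xy: "x \<in> {0..}" "y \<in> {0..}"
  have shrink: "(s * z) powr p \<le> s * z powr p" if "0 < s" "s < 1" "0 \<le> z" for s z :: real
  proof -
    have "s powr p \<le> s powr 1" using that assms by (intro powr_mono') auto
    then show ?thesis using that by (simp add: powr_mult mult_right_mono)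
  qed
  show "((1 - t) *\<^sub>R x + t *\<^sub>R y) powr p \<le> (1 - t) * x powr p + t * y powr p"
  proof (cases "x = 0 \<or> y = 0")
    case True
    then show ?thesis using shrink[of t y] shrink[of "1 - t" x] t xy by auto
  next
    case False
    then show ?thesis
      using convex_onD[OF powr_convex[OF assms], of t x y] t xy by auto
  qed
qed auto

lemma powr_jensen_sum:
  fixes p :: real and c a :: "'b \<Rightarrow> real"
  assumes "p \<ge> 1" "finite I" "(\<Sum>i\<in>I. c i) = 1" "\<And>i. i \<in> I \<Longrightarrow> 0 \<le> c i" "\<And>i. i \<in> I \<Longrightarrow> 0 \<le> a i"
  shows "(\<Sum>i\<in>I. c i * a i) powr p \<le> (\<Sum>i\<in>I. c i * a i powr p)"
proof -
  have "I \<noteq> {}" using assms(3) by auto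
  from convex_on_sum[OF assms(2) this convex_on_powr_nonneg[OF assms(1)] assms(3)] assms(4,5)
  show ?thesis by simp
qed

lemma powr_sum_le:
  fixes p :: real and a :: "'b \<Rightarrow> real"
  assumes "p \<ge> 1" "finite I" "I \<noteq> {}" "\<And>i. i \<in> I \<Longrightarrow> 0 \<le> a i"
  shows "(\<Sum>i\<in>I. a i) powr p \<le> real (card I) powr (p - 1) * (\<Sum>i\<in>I. a i powr p)"
proof -
  let ?N = "real (card I)"
  have N: "?N > 0" using assms by (simp add: card_gt_0_iff)
  have "(\<Sum>i\<in>I. a i) powr p = (?N * (\<Sum>i\<in>I. (1 / ?N) * a i)) powr p"
    using N by (simp flip: sum_divide_distrib)
  also have "\<dots> = ?N powr p * (\<Sum>i\<in>I. (1 / ?N) * a i) powr p"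
    using N assms(4) by (intro powr_mult)
  also have "\<dots> \<le> ?N powr p * (\<Sum>i\<in>I. (1 / ?N) * a i powr p)"
    using N assms by (intro mult_left_mono powr_jensen_sum) auto
  also have "\<dots> = ?N powr (p - 1) * (\<Sum>i\<in>I. a i powr p)"
    using N by (simp add: powr_diff flip: sum_divide_distrib)
  finally show ?thesis .
qed

text \<open>
  Telescoping and the power mean inequality: this is the price, in powers of \<open>N\<close>, of
  replacing one long jump by \<open>N\<close> consecutive short ones.
\<close>

lemma powr_abs_telescope:
  fixes p :: real and g :: "nat \<Rightarrow> real"
  assumes "p \<ge> 1" "N \<ge> 1"
  shows "\<bar>g N - g 0\<bar> powr p \<le> real N powr (p - 1) * (\<Sum>i<N. \<bar>g (Suc i) - g i\<bar> powr p)"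
proof -
  have "\<bar>g N - g 0\<bar> \<le> (\<Sum>i<N. \<bar>g (Suc i) - g i\<bar>)"
    using sum_abs[of "\<lambda>i. g (Suc i) - g i" "{..<N}"] by (simp add: sum_lessThan_telescope)
  then have "\<bar>g N - g 0\<bar> powr p \<le> (\<Sum>i<N. \<bar>g (Suc i) - g i\<bar>) powr p"
    using assms by (intro powr_mono2) auto
  also have "\<dots> \<le> real N powr (p - 1) * (\<Sum>i<N. \<bar>g (Suc i) - g i\<bar> powr p)"
    using powr_sum_le[of p "{..<N}"] assms by (auto simp: lessThan_empty_iff)
  finally show ?thesis .
qed

section \<open>Invariance of Lebesgue measure\<close>

lemma nn_integral_lborel_translate:
  fixes f :: "'a::euclidean_space \<Rightarrow> ennreal"
  assumes [measurable]: "f \<in> borel_measurable borel"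
  shows "(\<integral>\<^sup>+x. f (a + x) \<partial>lborel) = (\<integral>\<^sup>+x. f x \<partial>lborel)"
  by (subst (2) lborel_distr_plus[symmetric, of a]) (simp add: nn_integral_distr)

lemma nn_integral_lborel_scale:
  fixes f :: "'a::euclidean_space \<Rightarrow> ennreal"
  assumes [measurable]: "f \<in> borel_measurable borel" and c: "c > 0"
  shows "(\<integral>\<^sup>+x. f x \<partial>lborel) = ennreal (c ^ DIM('a)) * (\<integral>\<^sup>+x. f (c *\<^sub>R x) \<partial>lborel)"
  by (subst lborel_affine[of c 0]) (use c in \<open>simp_all add: nn_integral_density nn_integral_distr nn_integral_cmult\<close>)

text \<open>
  A shear along \<open>e\<close> translates every line parallel to \<open>e\<close> into itself, so it preserves the
  measure by slicing. To avoid splitting off a coordinate in the direction \<open>e\<close>, the slicing is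
  done with an auxiliary variable \<open>s\<close> and a weight \<open>\<phi>\<close> of integral 1. The weight is first placed
  at \<open>x \<bullet> e + s\<close>; translating \<open>x\<close> by \<open>-s e\<close> frees it from \<open>s\<close>, and then translating \<open>s\<close> by the
  amount of the shear removes the shear. The resulting double integral is the same for every
  shear, in particular for the trivial one.
\<close>

lemma nn_integral_lborel_shear:
  fixes F :: "'a::euclidean_space \<Rightarrow> ennreal" and g :: "'a \<Rightarrow> real"
  assumes [measurable]: "F \<in> borel_measurable borel" "g \<in> borel_measurable borel"
    and e: "norm e = 1" and g: "\<And>x s. g (x + s *\<^sub>R e) = g x"
  shows "(\<integral>\<^sup>+x. F (x + g x *\<^sub>R e) \<partial>lborel) = (\<integral>\<^sup>+x. F x \<partial>lborel)"
proof -
  have ee: "e \<bullet> e = 1" using e by (simp add: norm_eq_1)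
  let ?\<phi> = "\<lambda>t::real. indicator {0..1} t :: ennreal"
  have \<phi>: "(\<integral>\<^sup>+s. ?\<phi> (t + s) \<partial>lborel) = 1" for t
    by (subst nn_integral_lborel_translate[of ?\<phi>]) auto
  have slices: "(\<integral>\<^sup>+x. F (x + k x *\<^sub>R e) \<partial>lborel) =
      (\<integral>\<^sup>+x. \<integral>\<^sup>+s. F (x - s *\<^sub>R e) * ?\<phi> (x \<bullet> e) \<partial>lborel \<partial>lborel)"
    if [measurable]: "k \<in> borel_measurable borel" and k: "\<And>x s. k (x + s *\<^sub>R e) = k x"
    for k :: "'a \<Rightarrow> real"
  proof -
    have "(\<integral>\<^sup>+x. F (x + k x *\<^sub>R e) \<partial>lborel) =
        (\<integral>\<^sup>+x. \<integral>\<^sup>+s. F (x + k x *\<^sub>R e) * ?\<phi> (x \<bullet> e + s) \<partial>lborel \<partial>lborel)"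
      by (subst nn_integral_cmult, measurable, simp add: \<phi>)
    also have "\<dots> = (\<integral>\<^sup>+s. \<integral>\<^sup>+x. F (x + k x *\<^sub>R e) * ?\<phi> (x \<bullet> e + s) \<partial>lborel \<partial>lborel)"
      by (rule lborel_pair.Fubini') measurable
    also have "\<dots> = (\<integral>\<^sup>+s. \<integral>\<^sup>+x. F (x + k x *\<^sub>R e - s *\<^sub>R e) * ?\<phi> (x \<bullet> e) \<partial>lborel \<partial>lborel)"
    proof (rule nn_integral_cong)
      fix s
      have "k ((- s) *\<^sub>R e + x) = k x" for x using k[of x "- s"] by (simp add: add.commute)
      then show "(\<integral>\<^sup>+x. F (x + k x *\<^sub>R e) * ?\<phi> (x \<bullet> e + s) \<partial>lborel) =
          (\<integral>\<^sup>+x. F (x + k x *\<^sub>R e - s *\<^sub>R e) * ?\<phi> (x \<bullet> e) \<partial>lborel)"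
        by (subst nn_integral_lborel_translate[of _ "(- s) *\<^sub>R e", symmetric], measurable)
          (simp add: inner_add_left inner_diff_left ee algebra_simps)
    qed
    also have "\<dots> = (\<integral>\<^sup>+x. \<integral>\<^sup>+s. F (x + k x *\<^sub>R e - s *\<^sub>R e) * ?\<phi> (x \<bullet> e) \<partial>lborel \<partial>lborel)"
      by (rule lborel_pair.Fubini') measurable
    also have "\<dots> = (\<integral>\<^sup>+x. \<integral>\<^sup>+s. F (x - s *\<^sub>R e) * ?\<phi> (x \<bullet> e) \<partial>lborel \<partial>lborel)"
    proof (rule nn_integral_cong)
      fix x
      show "(\<integral>\<^sup>+s. F (x + k x *\<^sub>R e - s *\<^sub>R e) * ?\<phi> (x \<bullet> e) \<partial>lborel) =
          (\<integral>\<^sup>+s. F (x - s *\<^sub>R e) * ?\<phi> (x \<bullet> e) \<partial>lborel)"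
        by (subst nn_integral_lborel_translate[of _ "k x", symmetric], measurable)
          (simp add: algebra_simps)
    qed
    finally show ?thesis .
  qed
  have "(\<integral>\<^sup>+x. F (x + g x *\<^sub>R e) \<partial>lborel) = (\<integral>\<^sup>+x. F (x + 0 *\<^sub>R e) \<partial>lborel)"
    using slices[of g] slices[of "\<lambda>_. 0"] g by simp
  then show ?thesis by simp
qed

section \<open>The nonlocal energy and its Poincare inequality\<close>

text \<open>
  The set \<open>A\<close> restricts the increment \<open>y - x\<close> and not the pair: the total energy
  (\<open>A = UNIV\<close>) and the energy of jumps of length at most \<open>\<delta>\<close> (\<open>A = cball 0 \<delta>\<close>) can then both be
  integrated over the increment first.
\<close>

definition nonlocal_energy ::
    "real \<Rightarrow> ('a::euclidean_space \<Rightarrow> real) \<Rightarrow> 'a set \<Rightarrow> 'a set \<Rightarrow> ennreal" where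
  "nonlocal_energy p f U A =
     (\<integral>\<^sup>+x. \<integral>\<^sup>+y. ennreal (\<bar>f x - f y\<bar> powr p) *
        indicator U x * indicator U y * indicator A (y - x) \<partial>lborel \<partial>lborel)"

text \<open>
  The constant \<open>c\<close> is uniform in \<open>f\<close> and in \<open>\<delta>\<close>. The exponent is dictated by scaling: a chain
  of about \<open>1 / \<delta>\<close> jumps costs the power \<open>p\<close> by convexity, and short increments fill only a
  fraction of order \<open>\<delta> ^ DIM('a)\<close> of all increments.
\<close>

definition nonlocal_poincare :: "real \<Rightarrow> 'a::euclidean_space set \<Rightarrow> bool" where
  "nonlocal_poincare p U \<longleftrightarrow>
     (\<exists>c::real. \<forall>\<delta>. 0 < \<delta> \<longrightarrow> \<delta> \<le> 1 \<longrightarrow> (\<forall>f \<in> borel_measurable borel.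
        nonlocal_energy p f U UNIV
          \<le> ennreal (c * \<delta> powr - (p + real DIM('a))) * nonlocal_energy p f U (cball 0 \<delta>)))"

lemma nonlocal_energy_mono:
  assumes "U \<subseteq> U'" "A \<subseteq> A'"
  shows "nonlocal_energy p f U A \<le> nonlocal_energy p f U' A'"
  unfolding nonlocal_energy_def
  by (intro nn_integral_mono mult_mono) (use assms in \<open>auto simp: indicator_def\<close>)

lemma nonlocal_poincareI:
  fixes U :: "'a::euclidean_space set"
  assumes "\<And>\<delta> f. 0 < \<delta> \<Longrightarrow> \<delta> \<le> 1 \<Longrightarrow> f \<in> borel_measurable borel \<Longrightarrow>
        nonlocal_energy p f U UNIV
          \<le> ennreal (c * \<delta> powr - (p + real DIM('a))) * nonlocal_energy p f U (cball 0 \<delta>)"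
  shows "nonlocal_poincare p U"
  using assms unfolding nonlocal_poincare_def by blast

lemma nonlocal_poincareE:
  fixes U :: "'a::euclidean_space set"
  assumes "nonlocal_poincare p U"
  obtains c where "c \<ge> 0" and "\<And>\<delta> f. 0 < \<delta> \<Longrightarrow> \<delta> \<le> 1 \<Longrightarrow> f \<in> borel_measurable borel \<Longrightarrow>
        nonlocal_energy p f U UNIV
          \<le> ennreal (c * \<delta> powr - (p + real DIM('a))) * nonlocal_energy p f U (cball 0 \<delta>)"
proof -
  obtain c where c: "\<And>\<delta> f. 0 < \<delta> \<Longrightarrow> \<delta> \<le> 1 \<Longrightarrow> f \<in> borel_measurable borel \<Longrightarrow>
        nonlocal_energy p f U UNIV
          \<le> ennreal (c * \<delta> powr - (p + real DIM('a))) * nonlocal_energy p f U (cball 0 \<delta>)"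
    using assms unfolding nonlocal_poincare_def by blast
  show ?thesis
  proof (rule that[of "\<bar>c\<bar>"])
    fix \<delta> :: real and f :: "'a \<Rightarrow> real"
    assume "0 < \<delta>" "\<delta> \<le> 1" "f \<in> borel_measurable borel"
    note c[OF this]
    also have "ennreal (c * \<delta> powr - (p + real DIM('a))) \<le> ennreal (\<bar>c\<bar> * \<delta> powr - (p + real DIM('a)))"
      by (intro ennreal_leI mult_right_mono) auto
    finally show "nonlocal_energy p f U UNIV \<le>
        ennreal (\<bar>c\<bar> * \<delta> powr - (p + real DIM('a))) * nonlocal_energy p f U (cball 0 \<delta>)"
      by (simp add: mult_right_mono)
  qed auto
qed

section \<open>Convex sets: chains of short jumps\<close>

definition increment_energy :: "real \<Rightarrow> ('a::euclidean_space \<Rightarrow> real) \<Rightarrow> 'a set \<Rightarrow> 'a \<Rightarrow> ennreal" where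
  "increment_energy p f U w =
     (\<integral>\<^sup>+x. ennreal (\<bar>f x - f (x + w)\<bar> powr p) * indicator U x * indicator U (x + w) \<partial>lborel)"

lemma measurable_increment_energy [measurable]:
  assumes [measurable]: "f \<in> borel_measurable borel" "U \<in> sets borel"
  shows "increment_energy p f U \<in> borel_measurable borel"
  unfolding increment_energy_def by measurable

lemma nonlocal_energy_increments:
  fixes U :: "'a::euclidean_space set"
  assumes [measurable]: "f \<in> borel_measurable borel" "U \<in> sets borel" "A \<in> sets borel"
  shows "nonlocal_energy p f U A = (\<integral>\<^sup>+w. increment_energy p f U w * indicator A w \<partial>lborel)"
proof -
  have "nonlocal_energy p f U A =
     (\<integral>\<^sup>+x. \<integral>\<^sup>+w. ennreal (\<bar>f x - f (x + w)\<bar> powr p) *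
        indicator U x * indicator U (x + w) * indicator A w \<partial>lborel \<partial>lborel)"
    unfolding nonlocal_energy_def
  proof (rule nn_integral_cong)
    fix x :: 'a
    show "(\<integral>\<^sup>+y. ennreal (\<bar>f x - f y\<bar> powr p) *
        indicator U x * indicator U y * indicator A (y - x) \<partial>lborel) =
      (\<integral>\<^sup>+w. ennreal (\<bar>f x - f (x + w)\<bar> powr p) *
        indicator U x * indicator U (x + w) * indicator A w \<partial>lborel)"
      by (subst nn_integral_lborel_translate[symmetric, of _ x]) auto
  qed
  also have "\<dots> = (\<integral>\<^sup>+w. \<integral>\<^sup>+x. ennreal (\<bar>f x - f (x + w)\<bar> powr p) *
        indicator U x * indicator U (x + w) * indicator A w \<partial>lborel \<partial>lborel)"
  proof (rule lborel_pair.Fubini')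
    show "(\<lambda>(w, x). ennreal (\<bar>f x - f (x + w)\<bar> powr p) * indicator U x * indicator U (x + w) *
        indicator A w) \<in> borel_measurable (lborel \<Otimes>\<^sub>M lborel)"
      by measurable
  qed
  also have "\<dots> = (\<integral>\<^sup>+w. increment_energy p f U w * indicator A w \<partial>lborel)"
    unfolding increment_energy_def by (simp add: nn_integral_multc)
  finally show ?thesis .
qed

text \<open>
  The points \<open>x + i v\<close> with \<open>i \<le> N\<close> stay in the convex set once its two ends are there. After
  integration over \<open>x\<close> the \<open>N\<close> short jumps contribute equally, by translation invariance.
\<close>

lemma increment_energy_subdivide:
  fixes U :: "'a::euclidean_space set"
  assumes [measurable]: "f \<in> borel_measurable borel" "U \<in> sets borel"
    and "convex U" and "p \<ge> 1" and "N \<ge> 1"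
  shows "increment_energy p f U (real N *\<^sub>R v) \<le> ennreal (real N powr p) * increment_energy p f U v"
proof -
  define h where "h x = ennreal (\<bar>f x - f (x + v)\<bar> powr p) * indicator U x * indicator U (x + v)" for x
  have [measurable]: "h \<in> borel_measurable borel"
    unfolding h_def by measurable
  have pointwise: "ennreal (\<bar>f x - f (x + real N *\<^sub>R v)\<bar> powr p) * indicator U x * indicator U (x + real N *\<^sub>R v)
     \<le> ennreal (real N powr (p - 1)) * (\<Sum>i<N. h (real i *\<^sub>R v + x))" for x
  proof (cases "x \<in> U \<and> x + real N *\<^sub>R v \<in> U")
    case True
    have inU: "real i *\<^sub>R v + x \<in> U" if "i \<le> N" for i
    proof -
      have "(1 - real i / real N) *\<^sub>R x + (real i / real N) *\<^sub>R (x + real N *\<^sub>R v) \<in> U"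
        using True that \<open>N \<ge> 1\<close> by (intro convexD[OF \<open>convex U\<close>]) auto
      also have "(1 - real i / real N) *\<^sub>R x + (real i / real N) *\<^sub>R (x + real N *\<^sub>R v) = real i *\<^sub>R v + x"
        using \<open>N \<ge> 1\<close> by (simp add: algebra_simps)
      finally show ?thesis .
    qed
    have h: "h (real i *\<^sub>R v + x) = ennreal (\<bar>f (real (Suc i) *\<^sub>R v + x) - f (real i *\<^sub>R v + x)\<bar> powr p)"
      if "i < N" for i
      using inU[of i] inU[of "Suc i"] that by (simp add: h_def algebra_simps abs_minus_commute)
    have "\<bar>f (real N *\<^sub>R v + x) - f (real 0 *\<^sub>R v + x)\<bar> powr p
        \<le> real N powr (p - 1) * (\<Sum>i<N. \<bar>f (real (Suc i) *\<^sub>R v + x) - f (real i *\<^sub>R v + x)\<bar> powr p)"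
      by (rule powr_abs_telescope) fact+
    moreover have "(\<Sum>i<N. h (real i *\<^sub>R v + x)) =
        ennreal (\<Sum>i<N. \<bar>f (real (Suc i) *\<^sub>R v + x) - f (real i *\<^sub>R v + x)\<bar> powr p)"
      by (subst sum_ennreal[symmetric], simp) (intro sum.cong refl h, simp)
    ultimately show ?thesis
      using True by (simp add: ennreal_mult[symmetric] sum_nonneg ennreal_leI abs_minus_commute add.commute
          del: of_nat_Suc)
  qed auto
  have "increment_energy p f U (real N *\<^sub>R v)
    \<le> (\<integral>\<^sup>+x. ennreal (real N powr (p - 1)) * (\<Sum>i<N. h (real i *\<^sub>R v + x)) \<partial>lborel)"
    unfolding increment_energy_def by (intro nn_integral_mono pointwise)
  also have "\<dots> = ennreal (real N powr (p - 1)) * (\<Sum>i<N. \<integral>\<^sup>+x. h (real i *\<^sub>R v + x) \<partial>lborel)"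
    by (simp add: nn_integral_cmult nn_integral_sum)
  also have "(\<Sum>i<N. \<integral>\<^sup>+x. h (real i *\<^sub>R v + x) \<partial>lborel) = (\<Sum>i<N. increment_energy p f U v)"
    by (simp add: nn_integral_lborel_translate increment_energy_def flip: h_def)
  also have "ennreal (real N powr (p - 1)) * \<dots> = ennreal (real N powr p) * increment_energy p f U v"
  proof -
    have "real N powr p = real N powr (p - 1) * real N"
      using \<open>N \<ge> 1\<close> by (simp add: powr_diff)
    with \<open>N \<ge> 1\<close> show ?thesis by (simp add: ennreal_mult mult.assoc ennreal_of_nat_eq_real_of_nat)
  qed
  finally show ?thesis .
qed

text \<open>
  Every increment inside \<open>U\<close> has the form \<open>N v\<close> with \<open>v\<close> of length at most \<open>R / N\<close>; the
  substitution \<open>w = N v\<close> produces the additional factor \<open>N ^ DIM('a)\<close>.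
\<close>

lemma nonlocal_energy_convex:
  fixes U :: "'a::euclidean_space set"
  assumes [measurable]: "f \<in> borel_measurable borel" "U \<in> sets borel"
    and "convex U" and "p \<ge> 1" and N: "N \<ge> 1"
    and diam: "\<And>x y. x \<in> U \<Longrightarrow> y \<in> U \<Longrightarrow> norm (y - x) \<le> R"
  shows "nonlocal_energy p f U UNIV \<le>
     ennreal (real N powr (p + real DIM('a))) * nonlocal_energy p f U (cball 0 (R / real N))"
proof -
  have [measurable]: "cball 0 r \<in> sets (borel :: 'a measure)" for r
    by (simp add: borel_closed)
  have far: "increment_energy p f U w = increment_energy p f U w * indicator (cball 0 R) w" for w
  proof (cases "w \<in> cball 0 R")
    case False
    then have "indicator U x * indicator U (x + w) = (0::ennreal)" for x
      using diam[of x "x + w"] by (auto simp: indicator_def)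
    then have "increment_energy p f U w = 0"
      unfolding increment_energy_def by (simp only: mult.assoc) simp
    then show ?thesis by simp
  qed auto
  have ind: "indicator (cball 0 R) (real N *\<^sub>R v) = (indicator (cball 0 (R / real N)) v :: ennreal)" for v :: 'a
    using N by (auto simp: indicator_def field_simps)
  have "nonlocal_energy p f U UNIV = (\<integral>\<^sup>+w. increment_energy p f U w * indicator (cball 0 R) w \<partial>lborel)"
    using far by (simp add: nonlocal_energy_increments)
  also have "\<dots> = ennreal (real N ^ DIM('a)) *
      (\<integral>\<^sup>+v. increment_energy p f U (real N *\<^sub>R v) * indicator (cball 0 (R / real N)) v \<partial>lborel)"
    by (subst nn_integral_lborel_scale[of _ "real N"], measurable) (use N in \<open>auto simp: ind\<close>)
  also have "\<dots> \<le> ennreal (real N ^ DIM('a)) *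
      (\<integral>\<^sup>+v. ennreal (real N powr p) * (increment_energy p f U v * indicator (cball 0 (R / real N)) v) \<partial>lborel)"
    unfolding mult.assoc[symmetric]
    by (intro mult_left_mono nn_integral_mono mult_right_mono increment_energy_subdivide) (use assms in auto)
  also have "\<dots> = ennreal (real N powr (p + real DIM('a))) * nonlocal_energy p f U (cball 0 (R / real N))"
  proof -
    have "real N powr (p + real DIM('a)) = real N ^ DIM('a) * real N powr p"
      using N by (simp add: powr_add powr_realpow mult.commute)
    then have split: "ennreal (real N powr (p + real DIM('a))) = ennreal (real N ^ DIM('a)) * ennreal (real N powr p)"
      by (simp add: ennreal_mult)
    have near: "nonlocal_energy p f U (cball 0 (R / real N)) =
        (\<integral>\<^sup>+v. increment_energy p f U v * indicator (cball 0 (R / real N)) v \<partial>lborel)"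
      by (intro nonlocal_energy_increments) measurable
    show ?thesis
      unfolding split near mult.assoc
      by (intro arg_cong2[where f = "(*)"] refl nn_integral_cmult) measurable
  qed
  finally show ?thesis .
qed

lemma nonlocal_poincare_convex:
  fixes U :: "'a::euclidean_space set"
  assumes "p \<ge> 1" and "open U" and "bounded U" and "convex U"
  shows "nonlocal_poincare p U"
proof -
  obtain B where B: "B > 0" "\<And>x. x \<in> U \<Longrightarrow> norm x \<le> B"
    using \<open>bounded U\<close> bounded_pos by blast
  define R where "R = 2 * B"
  have R: "norm (y - x) \<le> R" if "x \<in> U" "y \<in> U" for x y
    using B(1) B(2)[of x] B(2)[of y] that norm_triangle_ineq4[of y x] unfolding R_def by linarith
  have Rpos: "R > 0" using B by (simp add: R_def)
  let ?s = "p + real DIM('a)"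
  show ?thesis
  proof (rule nonlocal_poincareI[of p U "(R + 1) powr ?s"])
    fix \<delta> :: real and f :: "'a \<Rightarrow> real"
    assume \<delta>: "0 < \<delta>" "\<delta> \<le> 1" and f: "f \<in> borel_measurable borel"
    \<comment> \<open>The least number of steps that makes each jump at most \<open>\<delta>\<close> long.\<close>
    define N where "N = nat \<lceil>R / \<delta>\<rceil>"
    have N: "R / \<delta> \<le> real N" "real N \<le> (R + 1) / \<delta>" "N \<ge> 1"
    proof -
      have "R / \<delta> > 0" using Rpos \<delta> by simp
      then show "R / \<delta> \<le> real N" "N \<ge> 1" unfolding N_def by linarith+
      have "real N \<le> R / \<delta> + 1" using \<open>R / \<delta> > 0\<close> unfolding N_def by linarith
      also have "\<dots> \<le> (R + 1) / \<delta>" using \<delta> by (simp add: field_simps)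
      finally show "real N \<le> (R + 1) / \<delta>" .
    qed
    have "R / real N \<le> \<delta>" using N \<delta> by (simp add: field_simps)
    have "nonlocal_energy p f U UNIV \<le>
        ennreal (real N powr ?s) * nonlocal_energy p f U (cball 0 (R / real N))"
      using f assms N R by (intro nonlocal_energy_convex) auto
    also have "\<dots> \<le> ennreal (((R + 1) / \<delta>) powr ?s) * nonlocal_energy p f U (cball 0 \<delta>)"
      using N \<open>R / real N \<le> \<delta>\<close> \<open>p \<ge> 1\<close>
      by (intro mult_mono ennreal_leI powr_mono2 nonlocal_energy_mono subset_cball) auto
    also have "((R + 1) / \<delta>) powr ?s = (R + 1) powr ?s * \<delta> powr - ?s"
      unfolding powr_minus_divide using Rpos \<delta> by (simp add: powr_divide)
    finally show "nonlocal_energy p f U UNIV \<le>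
        ennreal ((R + 1) powr ?s * \<delta> powr - ?s) * nonlocal_energy p f U (cball 0 \<delta>)" .
  qed
qed

section \<open>Transfer to regions above Lipschitz graphs\<close>

text \<open>
  Both energies are pulled back along \<open>\<Phi>\<close> without Jacobian. Jumps of length \<open>\<delta> / M\<close> in \<open>C\<close>
  become jumps of length at most \<open>\<delta>\<close> in \<open>U\<close>, so only the constant deteriorates.
\<close>

lemma nonlocal_poincare_image:
  fixes C U :: "'a::euclidean_space set"
  assumes C: "nonlocal_poincare p C" and [measurable]: "C \<in> sets borel" "U \<in> sets borel"
    and \<Phi>[measurable]: "\<Phi> \<in> borel_measurable borel"
    and pres: "\<And>F::'a \<Rightarrow> ennreal. F \<in> borel_measurable borel \<Longrightarrow>
      (\<integral>\<^sup>+x. F (\<Phi> x) \<partial>lborel) = (\<integral>\<^sup>+x. F x \<partial>lborel)"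
    and mem: "\<And>x. \<Phi> x \<in> U \<longleftrightarrow> x \<in> C"
    and M: "M \<ge> 1" and lip: "\<And>x y. norm (\<Phi> y - \<Phi> x) \<le> M * norm (y - x)"
  shows "nonlocal_poincare p U"
proof -
  let ?s = "p + real DIM('a)"
  obtain c where c: "c \<ge> 0" "\<And>\<delta> f. 0 < \<delta> \<Longrightarrow> \<delta> \<le> 1 \<Longrightarrow> f \<in> borel_measurable borel \<Longrightarrow>
        nonlocal_energy p f C UNIV
          \<le> ennreal (c * \<delta> powr - ?s) * nonlocal_energy p f C (cball 0 \<delta>)"
    by (rule nonlocal_poincareE[OF C]) blast
  have ind: "indicator U (\<Phi> x) = (indicator C x :: ennreal)" for x
    by (simp add: indicator_def mem)
  have pull: "nonlocal_energy p f U A = (\<integral>\<^sup>+x. \<integral>\<^sup>+y. ennreal (\<bar>f (\<Phi> x) - f (\<Phi> y)\<bar> powr p) *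
        indicator C x * indicator C y * indicator A (\<Phi> y - \<Phi> x) \<partial>lborel \<partial>lborel)"
    if [measurable]: "f \<in> borel_measurable borel" "A \<in> sets borel" for f A
    unfolding nonlocal_energy_def
    by (subst pres[symmetric], measurable, subst pres[symmetric], measurable) (simp add: ind)
  show ?thesis
  proof (rule nonlocal_poincareI[of p U "c * M powr ?s"])
    fix \<delta> :: real and f :: "'a \<Rightarrow> real"
    assume \<delta>: "0 < \<delta>" "\<delta> \<le> 1" and [measurable]: "f \<in> borel_measurable borel"
    have "\<delta> / M \<le> 1" using \<delta> M by (simp add: field_simps)
    have "nonlocal_energy p f U UNIV = nonlocal_energy p (\<lambda>x. f (\<Phi> x)) C UNIV"
      by (simp add: pull) (simp add: nonlocal_energy_def)
    also have "\<dots> \<le> ennreal (c * (\<delta> / M) powr - ?s) *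
        nonlocal_energy p (\<lambda>x. f (\<Phi> x)) C (cball 0 (\<delta> / M))"
      using \<delta> M \<open>\<delta> / M \<le> 1\<close> by (intro c) auto
    also have "\<dots> \<le> ennreal (c * (\<delta> / M) powr - ?s) * nonlocal_energy p f U (cball 0 \<delta>)"
    proof (intro mult_left_mono)
      have "\<Phi> y - \<Phi> x \<in> cball 0 \<delta>" if "y - x \<in> cball 0 (\<delta> / M)" for x y
        using lip[of y x] that M mult_left_mono[of "norm (y - x)" "\<delta> / M" M] by auto
      then show "nonlocal_energy p (\<lambda>x. f (\<Phi> x)) C (cball 0 (\<delta> / M)) \<le> nonlocal_energy p f U (cball 0 \<delta>)"
        by (simp add: pull) (auto simp: nonlocal_energy_def intro!: nn_integral_mono mult_left_mono split: split_indicator)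
    qed auto
    also have "(\<delta> / M) powr - ?s = M powr ?s * \<delta> powr - ?s"
      unfolding powr_minus_divide using M \<delta> by (simp add: powr_divide)
    finally show "nonlocal_energy p f U UNIV \<le>
        ennreal (c * M powr ?s * \<delta> powr - ?s) * nonlocal_energy p f U (cball 0 \<delta>)"
      by (simp add: mult.assoc)
  qed
qed

text \<open>
  The map \<open>x \<mapsto> x + g x e\<close> is a Lipschitz shear that carries the convex set \<open>C\<close> onto the region.
  It flattens the graph of \<open>g\<close>, so that a piece of the domain next to its boundary inherits the
  inequality of a cylinder.
\<close>

lemma nonlocal_poincare_graph_domain:
  fixes C :: "'a::euclidean_space set"
  assumes "p \<ge> 1" and C: "open C" "bounded C" "convex C"
    and e: "norm e = 1" and g: "\<And>x s. g (x + s *\<^sub>R e) = g x"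
    and lip: "L-lipschitz_on UNIV g"
  shows "open {x. x - g x *\<^sub>R e \<in> C}" and "nonlocal_poincare p {x. x - g x *\<^sub>R e \<in> C}"
proof -
  have cont [continuous_intros]: "continuous_on UNIV g"
    using lip lipschitz_on_continuous_on by blast
  then have [measurable]: "g \<in> borel_measurable borel"
    by (rule borel_measurable_continuous_onI)
  show op: "open {x. x - g x *\<^sub>R e \<in> C}"
  proof -
    have "open ((\<lambda>x. x - g x *\<^sub>R e) -` C)"
      using C by (intro open_vimage continuous_intros)
    then show ?thesis by (simp add: vimage_def)
  qed
  show "nonlocal_poincare p {x. x - g x *\<^sub>R e \<in> C}"
  proof (rule nonlocal_poincare_image[where C = C and \<Phi> = "\<lambda>x. x + g x *\<^sub>R e" and M = "1 + L"])
    show "nonlocal_poincare p C" using assms by (intro nonlocal_poincare_convex)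
    show "1 + L \<ge> 1" using lipschitz_on_nonneg[OF lip] by simp
    show "norm (y + g y *\<^sub>R e - (x + g x *\<^sub>R e)) \<le> (1 + L) * norm (y - x)" for x y
    proof -
      have "norm (y + g y *\<^sub>R e - (x + g x *\<^sub>R e)) = norm ((y - x) + (g y - g x) *\<^sub>R e)"
        by (simp add: algebra_simps)
      also have "\<dots> \<le> norm (y - x) + \<bar>g y - g x\<bar>"
        using norm_triangle_ineq[of "y - x" "(g y - g x) *\<^sub>R e"] e by simp
      also have "\<dots> \<le> (1 + L) * norm (y - x)"
        using lipschitz_onD[OF lip, of y x] by (simp add: dist_norm algebra_simps)
      finally show ?thesis .
    qed
  qed (use C op g e nn_integral_lborel_shear[of _ g e] in \<open>auto simp: borel_open\<close>)
qed

section \<open>Gluing overlapping sets\<close>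

text \<open>
  A jump from \<open>x \<in> U\<close> to \<open>y \<in> W\<close> is replaced by two jumps through a common point \<open>z \<in> U \<inter> W\<close>,
  the first inside \<open>U\<close> and the second inside \<open>W\<close>; then \<open>z\<close> is averaged over \<open>U \<inter> W\<close>.
\<close>

lemma cross_energy_le:
  fixes U W :: "'a::euclidean_space set"
  assumes [measurable]: "f \<in> borel_measurable borel" "U \<in> sets borel" "W \<in> sets borel"
    and "p \<ge> 1"
  shows "emeasure lborel (U \<inter> W) *
     (\<integral>\<^sup>+x. \<integral>\<^sup>+y. ennreal (\<bar>f x - f y\<bar> powr p) * indicator U x * indicator W y \<partial>lborel \<partial>lborel)
     \<le> ennreal (2 powr (p - 1)) * (emeasure lborel W * nonlocal_energy p f U UNIV +
          emeasure lborel U * nonlocal_energy p f W UNIV)" (is "_ * ?X \<le> ?k * _")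
proof -
  let ?h = "\<lambda>x y. ennreal (\<bar>f x - f y\<bar> powr p)"
  have tri: "?h x y \<le> ?k * (?h z x + ?h z y)" for x y z
  proof -
    have "\<bar>f x - f y\<bar> \<le> \<bar>f z - f x\<bar> + \<bar>f z - f y\<bar>" by linarith
    then have "\<bar>f x - f y\<bar> powr p \<le> (\<bar>f z - f x\<bar> + \<bar>f z - f y\<bar>) powr p"
      using \<open>p \<ge> 1\<close> by (intro powr_mono2) auto
    also have "\<dots> \<le> 2 powr (p - 1) * (\<bar>f z - f x\<bar> powr p + \<bar>f z - f y\<bar> powr p)"
      using powr_sum_le[OF \<open>p \<ge> 1\<close>, of "{True, False}" "\<lambda>b. if b then \<bar>f z - f x\<bar> else \<bar>f z - f y\<bar>"]
      by simp
    finally show ?thesis by (simp flip: ennreal_mult ennreal_plus)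
  qed
  have "emeasure lborel (U \<inter> W) * ?X =
      (\<integral>\<^sup>+z. \<integral>\<^sup>+x. \<integral>\<^sup>+y. indicator U z * indicator W z * (?h x y * indicator U x * indicator W y)
        \<partial>lborel \<partial>lborel \<partial>lborel)"
    by (simp add: nn_integral_cmult nn_integral_multc indicator_inter_arith[symmetric])
  also have "\<dots> \<le> (\<integral>\<^sup>+z. \<integral>\<^sup>+x. \<integral>\<^sup>+y. ?k * (?h z x * indicator U z * indicator U x * indicator W y
        + indicator U x * (?h z y * indicator W z * indicator W y)) \<partial>lborel \<partial>lborel \<partial>lborel)"
    by (intro nn_integral_mono) (use tri in \<open>auto split: split_indicator\<close>)
  also have "\<dots> = ?k * ((\<integral>\<^sup>+z. \<integral>\<^sup>+x. ?h z x * indicator U z * indicator U x * emeasure lborel W \<partial>lborel \<partial>lborel)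
        + (\<integral>\<^sup>+z. \<integral>\<^sup>+x. indicator U x * (\<integral>\<^sup>+y. ?h z y * indicator W z * indicator W y \<partial>lborel) \<partial>lborel \<partial>lborel))"
    by (simp add: nn_integral_cmult nn_integral_add)
  also have "\<dots> = ?k * (emeasure lborel W * nonlocal_energy p f U UNIV +
          emeasure lborel U * nonlocal_energy p f W UNIV)"
    unfolding nonlocal_energy_def by (simp add: nn_integral_cmult nn_integral_multc mult.commute)
  finally show ?thesis .
qed

lemma nonlocal_energy_Un_le:
  fixes U W :: "'a::euclidean_space set"
  assumes [measurable]: "f \<in> borel_measurable borel" "U \<in> sets borel" "W \<in> sets borel"
  shows "nonlocal_energy p f (U \<union> W) UNIV \<le> nonlocal_energy p f U UNIV + nonlocal_energy p f W UNIV
     + (\<integral>\<^sup>+x. \<integral>\<^sup>+y. ennreal (\<bar>f x - f y\<bar> powr p) * indicator U x * indicator W y \<partial>lborel \<partial>lborel)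
     + (\<integral>\<^sup>+x. \<integral>\<^sup>+y. ennreal (\<bar>f x - f y\<bar> powr p) * indicator W x * indicator U y \<partial>lborel \<partial>lborel)"
proof -
  let ?h = "\<lambda>x y. ennreal (\<bar>f x - f y\<bar> powr p)"
  have "nonlocal_energy p f (U \<union> W) UNIV \<le> (\<integral>\<^sup>+x. \<integral>\<^sup>+y. ?h x y * indicator U x * indicator U y
     + ?h x y * indicator W x * indicator W y + ?h x y * indicator U x * indicator W y
     + ?h x y * indicator W x * indicator U y \<partial>lborel \<partial>lborel)"
    unfolding nonlocal_energy_def
    by (intro nn_integral_mono) (auto split: split_indicator)
  also have "\<dots> = nonlocal_energy p f U UNIV + nonlocal_energy p f W UNIV
     + (\<integral>\<^sup>+x. \<integral>\<^sup>+y. ?h x y * indicator U x * indicator W y \<partial>lborel \<partial>lborel)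
     + (\<integral>\<^sup>+x. \<integral>\<^sup>+y. ?h x y * indicator W x * indicator U y \<partial>lborel \<partial>lborel)"
    unfolding nonlocal_energy_def by (simp add: nn_integral_add)
  finally show ?thesis .
qed

lemma ennreal_le_of_mult_le:
  assumes "ennreal m * X \<le> Y" "m > 0"
  shows "X \<le> ennreal (1 / m) * Y"
proof -
  have "X = ennreal (1 / m) * (ennreal m * X)"
    using assms(2) by (simp add: mult.assoc[symmetric] ennreal_mult[symmetric])
  also have "\<dots> \<le> ennreal (1 / m) * Y" using assms(1) by (intro mult_left_mono) auto
  finally show ?thesis .
qed

text \<open>
  The overlap is open and nonempty, so it has positive measure, and the energy between \<open>U\<close> and
  \<open>W\<close> is controlled by the energies inside them.
\<close>

lemma nonlocal_poincare_Un:
  fixes U W :: "'a::euclidean_space set"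
  assumes "p \<ge> 1" and U: "nonlocal_poincare p U" "open U" "bounded U"
    and W: "nonlocal_poincare p W" "open W" "bounded W" and ne: "U \<inter> W \<noteq> {}"
  shows "nonlocal_poincare p (U \<union> W)"
proof -
  let ?s = "p + real DIM('a)"
  have [measurable]: "U \<in> sets borel" "W \<in> sets borel" using U W by (auto simp: borel_open)
  obtain c where c: "c \<ge> 0" "\<And>\<delta> f. 0 < \<delta> \<Longrightarrow> \<delta> \<le> 1 \<Longrightarrow> f \<in> borel_measurable borel \<Longrightarrow>
        nonlocal_energy p f U UNIV
          \<le> ennreal (c * \<delta> powr - ?s) * nonlocal_energy p f U (cball 0 \<delta>)"
    by (rule nonlocal_poincareE[OF U(1)]) blast
  obtain d where d: "d \<ge> 0" "\<And>\<delta> f. 0 < \<delta> \<Longrightarrow> \<delta> \<le> 1 \<Longrightarrow> f \<in> borel_measurable borel \<Longrightarrow>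
        nonlocal_energy p f W UNIV
          \<le> ennreal (d * \<delta> powr - ?s) * nonlocal_energy p f W (cball 0 \<delta>)"
    by (rule nonlocal_poincareE[OF W(1)]) blast
  define m where "m = measure lborel (U \<inter> W)"
  define a where "a = measure lborel U + measure lborel W"
  have fin: "emeasure lborel U = ennreal (measure lborel U)" "emeasure lborel W = ennreal (measure lborel W)"
    "emeasure lborel (U \<inter> W) = ennreal m"
    unfolding m_def
    by (rule emeasure_eq_ennreal_measure,
        use U W emeasure_bounded_finite[of U] emeasure_bounded_finite[of W] emeasure_bounded_finite[of "U \<inter> W"]
        in \<open>auto simp: bounded_Int\<close>)+
  have "m > 0"
  proof -
    obtain x where "x \<in> U \<inter> W" using ne by auto
    moreover have "open (U \<inter> W)" using U W by auto
    ultimately obtain r where r: "r > 0" "ball x r \<subseteq> U \<inter> W" by (meson open_contains_ball)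
    have "0 < emeasure lborel (ball x r)" using r by (simp add: emeasure_ball)
    also have "\<dots> \<le> emeasure lborel (U \<inter> W)" using r by (intro emeasure_mono) auto
    finally show ?thesis by (simp add: fin)
  qed
  define k where "k = 2 powr (p - 1) / m"
  have k: "k \<ge> 0" using \<open>m > 0\<close> by (simp add: k_def)
  have a: "a \<ge> 0" by (simp add: a_def)
  show ?thesis
  proof (rule nonlocal_poincareI[of p _ "(1 + 2 * (k * a)) * (c + d)"])
    fix \<delta> :: real and f :: "'a \<Rightarrow> real"
    assume \<delta>: "0 < \<delta>" "\<delta> \<le> 1" and [measurable]: "f \<in> borel_measurable borel"
    let ?EU = "nonlocal_energy p f U UNIV" and ?EW = "nonlocal_energy p f W UNIV"
    let ?E\<delta> = "nonlocal_energy p f (U \<union> W) (cball 0 \<delta>)"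
    let ?X = "\<lambda>U W. \<integral>\<^sup>+x. \<integral>\<^sup>+y. ennreal (\<bar>f x - f y\<bar> powr p) * indicator U x * indicator W y \<partial>lborel \<partial>lborel"
    have absorb: "emeasure lborel W * ?EU + emeasure lborel U * ?EW \<le> ennreal a * (?EU + ?EW)"
      unfolding distrib_left fin a_def by (intro add_mono mult_right_mono ennreal_leI) auto
    have cross: "?X U W \<le> ennreal (k * a) * (?EU + ?EW)" "?X W U \<le> ennreal (k * a) * (?EU + ?EW)"
    proof -
      have "ennreal m * ?X U W \<le> ennreal (2 powr (p - 1)) * (ennreal a * (?EU + ?EW))"
        using order_trans[OF cross_energy_le[of f U W p] mult_left_mono[OF absorb]] \<open>p \<ge> 1\<close>
        by (simp flip: fin(3))
      from ennreal_le_of_mult_le[OF this \<open>m > 0\<close>]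
      show "?X U W \<le> ennreal (k * a) * (?EU + ?EW)"
        using \<open>m > 0\<close> a by (simp add: mult.assoc[symmetric] ennreal_mult[symmetric] k_def)
      have "ennreal m * ?X W U \<le> ennreal (2 powr (p - 1)) * (ennreal a * (?EU + ?EW))"
        using order_trans[OF cross_energy_le[of f W U p, unfolded add.commute[of "emeasure lborel U * _"]]
            mult_left_mono[OF absorb]] \<open>p \<ge> 1\<close>
        by (simp add: Int_commute flip: fin(3))
      from ennreal_le_of_mult_le[OF this \<open>m > 0\<close>]
      show "?X W U \<le> ennreal (k * a) * (?EU + ?EW)"
        using \<open>m > 0\<close> a by (simp add: mult.assoc[symmetric] ennreal_mult[symmetric] k_def)
    qed
    have "nonlocal_energy p f (U \<union> W) UNIV \<le> ?EU + ?EW + ?X U W + ?X W U"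
      by (rule nonlocal_energy_Un_le) measurable
    also have "\<dots> \<le> (?EU + ?EW) + ennreal (k * a) * (?EU + ?EW) + ennreal (k * a) * (?EU + ?EW)"
      by (intro add_mono cross order_refl)
    also have "\<dots> = ennreal (1 + 2 * (k * a)) * (?EU + ?EW)"
      using k a by (simp add: ennreal_mult distrib_right ennreal_plus mult.assoc flip: mult_2)
    also have "\<dots> \<le> ennreal (1 + 2 * (k * a)) *
        (ennreal (c * \<delta> powr - ?s) * ?E\<delta> + ennreal (d * \<delta> powr - ?s) * ?E\<delta>)"
    proof (intro mult_left_mono add_mono)
      show "?EU \<le> ennreal (c * \<delta> powr - ?s) * ?E\<delta>"
        by (rule order_trans[OF c(2)[OF \<delta>]]) (auto intro!: mult_left_mono nonlocal_energy_mono)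
      show "?EW \<le> ennreal (d * \<delta> powr - ?s) * ?E\<delta>"
        by (rule order_trans[OF d(2)[OF \<delta>]]) (auto intro!: mult_left_mono nonlocal_energy_mono)
    qed auto
    also have "\<dots> = ennreal ((1 + 2 * (k * a)) * (c + d) * \<delta> powr - ?s) * ?E\<delta>"
      using c(1) d(1) k a
      by (simp add: distrib_right[symmetric] ennreal_plus[symmetric] ennreal_mult[symmetric] mult.assoc[symmetric]
          del: ennreal_plus)
    finally show "nonlocal_energy p f (U \<union> W) UNIV \<le>
        ennreal ((1 + 2 * (k * a)) * (c + d) * \<delta> powr - ?s) * ?E\<delta>" .
  qed
qed

text \<open>
  A maximal subfamily whose union satisfies the inequality must be the whole family: otherwise
  connectedness makes its union meet one of the remaining open sets, which can be glued to it.
\<close>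

lemma nonlocal_poincare_connected_Union:
  fixes \<U> :: "'a::euclidean_space set set"
  assumes "p \<ge> 1" and fin: "finite \<U>" and ne: "\<Union>\<U> \<noteq> {}" and conn: "connected (\<Union>\<U>)"
    and U: "\<And>U. U \<in> \<U> \<Longrightarrow> nonlocal_poincare p U \<and> open U \<and> bounded U"
  shows "nonlocal_poincare p (\<Union>\<U>)"
proof -
  let ?good = "\<lambda>\<A>. \<A> \<subseteq> \<U> \<and> \<Union>\<A> \<noteq> {} \<and> nonlocal_poincare p (\<Union>\<A>)"
  obtain U0 where "U0 \<in> \<U>" "U0 \<noteq> {}" using ne by auto
  then have "?good {U0}" using U by auto
  have "finite {\<A>. ?good \<A>}"
    by (rule finite_subset[of _ "Pow \<U>"]) (use fin in auto)
  obtain \<A> where \<A>: "?good \<A>" and max: "\<And>\<B>. ?good \<B> \<Longrightarrow> \<A> \<subseteq> \<B> \<Longrightarrow> \<A> = \<B>"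
  proof -
    have "{\<A>. ?good \<A>} \<noteq> {}" using \<open>?good {U0}\<close> by (metis (mono_tags) empty_iff mem_Collect_eq)
    from finite_has_maximal[OF \<open>finite {\<A>. ?good \<A>}\<close> this]
    obtain \<A> where m: "\<A> \<in> {\<A>. ?good \<A>}" "\<forall>\<B>\<in>{\<A>. ?good \<A>}. \<A> \<le> \<B> \<longrightarrow> \<A> = \<B>" ..
    show thesis
    proof (rule that[of \<A>])
      show "?good \<A>" using m(1) by (rule CollectD)
      show "\<A> = \<B>" if "?good \<B>" "\<A> \<subseteq> \<B>" for \<B>
        using m(2) that by simp
    qed
  qed
  have "\<Union>(\<U> - \<A>) = {}"
  proof (rule ccontr)
    assume rest: "\<Union>(\<U> - \<A>) \<noteq> {}"
    have "open (\<Union>\<A>)" "open (\<Union>(\<U> - \<A>))" using \<A> U by blast+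
    moreover have "\<Union>\<U> \<subseteq> \<Union>\<A> \<union> \<Union>(\<U> - \<A>)" by blast
    ultimately have "\<Union>\<A> \<inter> \<Union>(\<U> - \<A>) \<noteq> {}"
      using connectedD[OF conn, of "\<Union>\<A>" "\<Union>(\<U> - \<A>)"] \<A> rest by auto
    then obtain W where W: "W \<in> \<U>" "W \<notin> \<A>" "\<Union>\<A> \<inter> W \<noteq> {}" by auto
    have "bounded (\<Union>\<A>)" using \<A> fin U by (intro bounded_Union) (auto intro: finite_subset)
    then have "nonlocal_poincare p (\<Union>\<A> \<union> W)"
      using W U \<A> \<open>open (\<Union>\<A>)\<close> \<open>p \<ge> 1\<close> by (intro nonlocal_poincare_Un) auto
    then have "?good (insert W \<A>)" using W \<A> by (auto simp: Un_commute)
    from max[OF this] W show False by auto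
  qed
  then have "\<Union>\<U> = \<Union>\<A>" using \<A> by auto
  then show ?thesis using \<A> by simp
qed

section \<open>Bounded connected Lipschitz domains\<close>

text \<open>
  Around an interior point a ball will do. At a boundary point the set is a sheared cylinder
  above the graph, with axis \<open>e\<close>; its radius and height must be small enough for it to remain in
  the ball on which \<open>\<Omega>\<close> is known to be the region above the graph.
\<close>

lemma lipschitz_boundary_local_poincare:
  fixes \<Omega> :: "(real^'d) set"
  assumes "p \<ge> 1" and "open \<Omega>" and "lipschitz_boundary \<Omega>" and z: "z \<in> closure \<Omega>"
  shows "\<exists>s>0. \<exists>U. open U \<and> bounded U \<and> U \<subseteq> \<Omega> \<and> \<Omega> \<inter> ball z s \<subseteq> U \<and> nonlocal_poincare p U"
proof (cases "z \<in> \<Omega>")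
  case True
  then obtain s where "s > 0" "ball z s \<subseteq> \<Omega>" using \<open>open \<Omega>\<close> open_contains_ball by blast
  then show ?thesis using \<open>p \<ge> 1\<close> by (intro exI[of _ s] conjI exI[of _ "ball z s"] nonlocal_poincare_convex) auto
next
  case False
  then have "z \<in> frontier \<Omega>" using z \<open>open \<Omega>\<close> by (simp add: frontier_def interior_open)
  then obtain r e g L where r: "r > 0" and e: "norm e = 1" and lip: "L-lipschitz_on {y. y \<bullet> e = 0} g"
    and region: "\<Omega> \<inter> ball z r = {x \<in> ball z r. g (x - (x \<bullet> e) *\<^sub>R e) < x \<bullet> e}"
    using \<open>lipschitz_boundary \<Omega>\<close> unfolding lipschitz_boundary_def by meson
  have ee: "e \<bullet> e = 1" using e by (simp add: norm_eq_1)
  \<comment> \<open>\<open>P\<close> projects onto the hyperplane that carries \<open>g\<close>; \<open>G\<close> extends \<open>g\<close> constantly along \<open>e\<close>.\<close>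
  define P where "P x = x - (x \<bullet> e) *\<^sub>R e" for x :: "real^'d"
  define G where "G x = g (P x)" for x
  have lin: "linear P"
    unfolding P_def by (intro linearI) (auto simp: inner_add_left algebra_simps)
  have P_diff: "P (x - y) = P x - P y" for x y using lin by (rule linear_diff)
  have P_perp: "P x \<bullet> e = 0" for x by (simp add: P_def inner_diff_left ee)
  have P_shift: "P (x + s *\<^sub>R e) = P x" for x s by (simp add: P_def inner_add_left ee algebra_simps)
  have P_norm: "norm (P x) \<le> norm x" for x
  proof -
    have "P x \<bullet> P x = x \<bullet> x - (x \<bullet> e)\<^sup>2"
      by (simp add: P_def inner_diff_left inner_diff_right ee inner_commute power2_eq_square)
    also have "\<dots> \<le> x \<bullet> x" by simp
    finally show ?thesis by (simp add: norm_le)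
  qed
  have L: "L \<ge> 0" using lip by (rule lipschitz_on_nonneg)
  have G_le: "\<bar>G x - G y\<bar> \<le> L * norm (P (x - y))" for x y
    using lipschitz_onD[OF lip, of "P x" "P y"] by (simp add: P_perp G_def dist_norm P_diff)
  have G_lip: "L-lipschitz_on UNIV G"
  proof (rule lipschitz_onI)
    fix x y
    show "dist (G x) (G y) \<le> L * dist x y"
      using G_le[of x y] mult_left_mono[OF P_norm[of "x - y"] L] by (simp add: dist_norm)
  qed (rule L)
  have region': "x \<in> \<Omega> \<longleftrightarrow> G x < x \<bullet> e" if "x \<in> ball z r" for x
  proof -
    have "x \<in> \<Omega> \<inter> ball z r \<longleftrightarrow> x \<in> {x \<in> ball z r. g (x - (x \<bullet> e) *\<^sub>R e) < x \<bullet> e}"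
      by (simp only: region)
    then show ?thesis using that by (simp add: G_def P_def)
  qed
  \<comment> \<open>A boundary point lies on the graph: it is not in the open set \<open>\<Omega>\<close>, but points of \<open>\<Omega>\<close> approach it.\<close>
  have Gz: "G z = z \<bullet> e"
  proof (rule antisym)
    show "z \<bullet> e \<le> G z" using region'[of z] r False by simp
    show "G z \<le> z \<bullet> e"
    proof (rule ccontr)
      assume above: "\<not> G z \<le> z \<bullet> e"
      have "continuous_on UNIV G" using G_lip by (rule lipschitz_on_continuous_on)
      then have "open {x. x \<bullet> e < G x}" by (intro open_Collect_less continuous_intros)
      then have "open ({x. x \<bullet> e < G x} \<inter> ball z r)" by auto
      moreover have "z \<in> {x. x \<bullet> e < G x} \<inter> ball z r" using above r by simp
      ultimately have "\<Omega> \<inter> ({x. x \<bullet> e < G x} \<inter> ball z r) \<noteq> {}"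
        using z by (subst (asm) closure_iff_nhds_not_empty) blast
      then obtain x where "x \<in> \<Omega>" "x \<bullet> e < G x" "x \<in> ball z r"
        by blast
      then show False using region'[of x] by simp
    qed
  qed
  \<comment> \<open>A point of the sheared cylinder has distance at most \<open>t (1 + L) + h = 3 r / 4\<close> from \<open>z\<close>.\<close>
  define t where "t = r / (4 * (1 + L))"
  define h where "h = r / 2"
  have t: "t > 0" "t \<le> r / 4" "t * (1 + L) = r / 4" using r L by (auto simp: t_def field_simps)
  define C where "C = P -` ball (P z) t \<inter> {w. 0 < w \<bullet> e \<and> w \<bullet> e < h}"
  define U where "U = {x. x - G x *\<^sub>R e \<in> C}"
  have C: "open C" "bounded C" "convex C"
  proof -
    have "continuous_on UNIV P" using lin by (rule linear_continuous_on_compose[OF continuous_on_id, simplified])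
    then have "open (P -` ball (P z) t)" by (intro open_vimage) auto
    moreover have "open {w. 0 < w \<bullet> e \<and> w \<bullet> e < h}"
      by (intro open_Collect_conj open_Collect_less continuous_intros)
    ultimately show "open C" unfolding C_def by (rule open_Int)
    have "{w. 0 < w \<bullet> e \<and> w \<bullet> e < h} = {w. 0 < e \<bullet> w} \<inter> {w. e \<bullet> w < h}"
      by (auto simp: inner_commute)
    moreover have "convex ({w. 0 < e \<bullet> w} \<inter> {w. e \<bullet> w < h})"
      by (intro convex_Int convex_halfspace_lt convex_halfspace_gt)
    ultimately have "convex {w. 0 < w \<bullet> e \<and> w \<bullet> e < h}" by simp
    then show "convex C" unfolding C_def
      by (rule convex_Int[OF convex_linear_vimage[OF lin convex_ball]])
    have "norm w \<le> norm (P z) + t + h" if "w \<in> C" for w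
    proof -
      have "norm w \<le> norm (P w) + norm ((w \<bullet> e) *\<^sub>R e)"
        using norm_triangle_ineq[of "P w" "(w \<bullet> e) *\<^sub>R e"] by (simp add: P_def)
      moreover have "norm (P w) \<le> norm (P z) + t"
        using that norm_triangle_ineq2[of "P w" "P z"] by (auto simp: C_def dist_norm norm_minus_commute)
      moreover have "norm ((w \<bullet> e) *\<^sub>R e) \<le> h" using that e by (auto simp: C_def)
      ultimately show ?thesis by linarith
    qed
    then show "bounded C" by (auto simp: bounded_iff)
  qed
  have U_iff: "x \<in> U \<longleftrightarrow> norm (P (x - z)) < t \<and> 0 < x \<bullet> e - G x \<and> x \<bullet> e - G x < h" for x
  proof -
    have "P (x - G x *\<^sub>R e) = P x" using P_shift[of x "- G x"] by simp
    then show ?thesis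
      by (simp add: U_def C_def inner_diff_left ee dist_norm P_diff norm_minus_commute)
  qed
  have U_ball: "U \<subseteq> ball z r"
  proof
    fix x assume "x \<in> U"
    then have x: "norm (P (x - z)) < t" "0 < x \<bullet> e - G x" "x \<bullet> e - G x < h" by (auto simp: U_iff)
    have "\<bar>G x - G z\<bar> \<le> L * t"
      using G_le[of x z] mult_left_mono[of "norm (P (x - z))" t L] x L by linarith
    then have "\<bar>(x - z) \<bullet> e\<bar> < h + L * t" using x Gz unfolding inner_diff_left by linarith
    moreover have "norm (x - z) \<le> norm (P (x - z)) + \<bar>(x - z) \<bullet> e\<bar>"
      using norm_triangle_ineq[of "P (x - z)" "((x - z) \<bullet> e) *\<^sub>R e"] e by (simp add: P_def)
    ultimately have "norm (x - z) < t * (1 + L) + h" using x(1) by (simp add: algebra_simps)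
    also have "\<dots> < r" using t r by (simp add: h_def)
    finally show "x \<in> ball z r" by (simp add: dist_norm norm_minus_commute)
  qed
  have G_inv: "G (x + s *\<^sub>R e) = G x" for x s by (simp add: G_def P_shift)
  show ?thesis
  proof (intro exI[of _ t] conjI exI[of _ U])
    show "t > 0" by fact
    show "open U" "nonlocal_poincare p U"
      unfolding U_def using nonlocal_poincare_graph_domain[OF \<open>p \<ge> 1\<close> C e G_inv G_lip] by auto
    show "bounded U" using U_ball bounded_ball bounded_subset by blast
    show "U \<subseteq> \<Omega>" using U_ball region' U_iff by force
    show "\<Omega> \<inter> ball z t \<subseteq> U"
    proof
      fix x assume x: "x \<in> \<Omega> \<inter> ball z t"
      then have xz: "norm (x - z) < t" by (simp add: dist_norm norm_minus_commute)
      have "x \<in> ball z r" using x t r by auto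
      then have "G x < x \<bullet> e" using region' x by auto
      moreover have "\<bar>G x - G z\<bar> \<le> L * t"
        using G_le[of x z] mult_left_mono[of "norm (P (x - z))" t L] P_norm[of "x - z"] xz L by linarith
      moreover have "\<bar>(x - z) \<bullet> e\<bar> \<le> norm (x - z)"
        using Cauchy_Schwarz_ineq2[of "x - z" e] e by simp
      ultimately have "x \<bullet> e - G x < t * (1 + L)"
        using xz Gz by (simp add: inner_diff_left algebra_simps)
      also have "\<dots> \<le> h" using t r by (simp add: h_def)
      finally show "x \<in> U"
        using \<open>G x < x \<bullet> e\<close> P_norm[of "x - z"] xz by (simp add: U_iff)
    qed
  qed
qed

text \<open>
  Compactness of the closure leaves finitely many of the local sets, and together they exhaust
  \<open>\<Omega>\<close> itself; they are then glued along the connected domain.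
\<close>

lemma nonlocal_poincare_lipschitz_domain:
  fixes \<Omega> :: "(real^'d) set"
  assumes "p \<ge> 1" and "open \<Omega>" and "bounded \<Omega>" and "connected \<Omega>" and "\<Omega> \<noteq> {}"
    and "lipschitz_boundary \<Omega>"
  shows "nonlocal_poincare p \<Omega>"
proof -
  have "\<forall>z\<in>closure \<Omega>. \<exists>s U. s > 0 \<and> open U \<and> bounded U \<and> U \<subseteq> \<Omega> \<and> \<Omega> \<inter> ball z s \<subseteq> U \<and> nonlocal_poincare p U"
    using lipschitz_boundary_local_poincare[OF assms(1,2,6)] by meson
  then obtain s U where sU: "\<And>z. z \<in> closure \<Omega> \<Longrightarrow> s z > 0 \<and> open (U z) \<and> bounded (U z) \<and> U z \<subseteq> \<Omega> \<and>
      \<Omega> \<inter> ball z (s z) \<subseteq> U z \<and> nonlocal_poincare p (U z)"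
    by metis
  have "compact (closure \<Omega>)" using \<open>bounded \<Omega>\<close> by simp
  then obtain Z where Z: "Z \<subseteq> closure \<Omega>" "finite Z" "closure \<Omega> \<subseteq> (\<Union>z\<in>Z. ball z (s z))"
  proof (rule compactE_image[of _ "closure \<Omega>" "\<lambda>z. ball z (s z)"])
    show "closure \<Omega> \<subseteq> (\<Union>z\<in>closure \<Omega>. ball z (s z))" using sU by fastforce
  qed auto
  have eq: "\<Union>(U ` Z) = \<Omega>"
  proof
    show "\<Union>(U ` Z) \<subseteq> \<Omega>" using sU Z(1) by blast
    show "\<Omega> \<subseteq> \<Union>(U ` Z)"
    proof
      fix x assume "x \<in> \<Omega>"
      then obtain z where "z \<in> Z" "x \<in> ball z (s z)" using Z(3) closure_subset by blast
      then show "x \<in> \<Union>(U ` Z)" using sU[of z] Z(1) \<open>x \<in> \<Omega>\<close> by blast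
    qed
  qed
  have "nonlocal_poincare p (\<Union>(U ` Z))"
    using assms Z sU by (intro nonlocal_poincare_connected_Union) (auto simp: eq)
  then show ?thesis by (simp add: eq)
qed

section \<open>From the domain to the graph\<close>

text \<open>
  Sums over \<open>V\<close> with weights \<open>\<nu>\<close> are integrals over \<open>\<Omega>\<close> along \<open>T\<close>. The density lies between
  \<open>1 / D\<close> and \<open>D\<close>, so each side is at most \<open>D\<close> times the other when it is replaced by Lebesgue
  measure.
\<close>

lemma transport_sum_bounds:
  fixes \<Omega> V :: "'a::euclidean_space set" and F :: "'a \<Rightarrow> ennreal"
  assumes "open \<Omega>" and V: "finite V" and T: "T \<in> restrict_space borel \<Omega> \<rightarrow>\<^sub>M restrict_space borel V"
    and \<nu>: "distr (density (restrict_space lborel \<Omega>) (\<lambda>x. ennreal (\<rho> x))) (restrict_space borel V) T = \<nu>"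
    and "prob_space \<nu>" and \<rho>: "continuous_on \<Omega> \<rho>"
    and D: "D > 0" "\<And>x. x \<in> \<Omega> \<Longrightarrow> 1 / D \<le> \<rho> x \<and> \<rho> x \<le> D"
  shows "(\<Sum>x\<in>V. F x * ennreal (measure \<nu> {x})) \<le> ennreal D * (\<integral>\<^sup>+x. F (T x) * indicator \<Omega> x \<partial>lborel)" (is "?S \<le> _ * ?I")
    and "(\<integral>\<^sup>+x. F (T x) * indicator \<Omega> x \<partial>lborel) \<le> ennreal D * (\<Sum>x\<in>V. F x * ennreal (measure \<nu> {x}))"
proof -
  interpret prob_space \<nu> by fact
  have sets_V: "sets (restrict_space borel V) = Pow V"
  proof -
    have "A \<in> (\<inter>) V ` sets borel" if "A \<subseteq> V" for A
    proof (rule image_eqI)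
      show "A = V \<inter> A" using that by (rule Int_absorb1[symmetric])
      show "A \<in> sets borel"
        using finite_imp_closed[OF finite_subset[OF that V]] by (rule borel_closed)
    qed
    then show ?thesis unfolding sets_restrict_space by blast
  qed
  have sets_\<nu>: "sets \<nu> = Pow V" "space \<nu> = V"
    using sets_V by (auto simp: \<nu>[symmetric] space_restrict_space)
  have meas: "F \<in> borel_measurable (restrict_space borel V)"
    by (rule measurableI) (auto simp: sets_V space_restrict_space)
  have [measurable]: "\<Omega> \<in> sets borel" using \<open>open \<Omega>\<close> by (rule borel_open)
  have sets_\<Omega>: "sets (restrict_space lborel \<Omega>) = sets (restrict_space borel \<Omega>)"
    by (intro sets_restrict_space_cong) simp
  have T': "T \<in> restrict_space lborel \<Omega> \<rightarrow>\<^sub>M restrict_space borel V"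
    using T by (simp cong: measurable_cong_sets add: measurable_cong_sets[OF sets_\<Omega> refl])
  have FT: "(\<lambda>x. F (T x)) \<in> borel_measurable (restrict_space lborel \<Omega>)"
    using measurable_compose[OF T' meas] .
  have \<rho>': "(\<lambda>x. ennreal (\<rho> x)) \<in> borel_measurable (restrict_space lborel \<Omega>)"
    using borel_measurable_continuous_on_restrict[OF \<rho>]
    by (subst measurable_cong_sets[OF sets_\<Omega> refl]) measurable
  have "?S = (\<Sum>x\<in>V. F x * emeasure \<nu> {x})"
    by (simp add: emeasure_eq_measure)
  also have "\<dots> = (\<integral>\<^sup>+y. (\<Sum>x\<in>V. F x * indicator {x} y) \<partial>\<nu>)"
    by (subst nn_integral_sum) (auto simp: nn_integral_cmult sets_\<nu> measurable_def)
  also have "\<dots> = (\<integral>\<^sup>+y. F y \<partial>\<nu>)"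
    using V by (intro nn_integral_cong) (auto simp: sets_\<nu> indicator_def if_distrib cong: if_cong)
  also have "\<dots> = (\<integral>\<^sup>+x. ennreal (\<rho> x) * F (T x) \<partial>restrict_space lborel \<Omega>)"
    unfolding \<nu>[symmetric] using T' meas FT \<rho>' by (subst nn_integral_distr) (auto simp: nn_integral_density)
  also have "\<dots> = (\<integral>\<^sup>+x. ennreal (\<rho> x) * F (T x) * indicator \<Omega> x \<partial>lborel)"
    by (simp add: nn_integral_restrict_space)
  finally have S: "?S = (\<integral>\<^sup>+x. ennreal (\<rho> x) * F (T x) * indicator \<Omega> x \<partial>lborel)" .
  have mFT: "(\<lambda>x. F (T x) * indicator \<Omega> x) \<in> borel_measurable lborel"
    using FT by (subst (asm) borel_measurable_restrict_space_iff_ennreal) auto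
  have m\<rho>FT: "(\<lambda>x. ennreal (\<rho> x) * F (T x) * indicator \<Omega> x) \<in> borel_measurable lborel"
    using borel_measurable_times_ennreal[OF \<rho>' FT] by (subst (asm) borel_measurable_restrict_space_iff_ennreal) auto
  show "?S \<le> ennreal D * ?I"
    unfolding S nn_integral_cmult[OF mFT, symmetric]
    using D by (intro nn_integral_mono) (auto simp: mult.assoc intro!: mult_right_mono ennreal_leI split: split_indicator)
  show "?I \<le> ennreal D * ?S"
    unfolding S nn_integral_cmult[OF m\<rho>FT, symmetric]
  proof (intro nn_integral_mono)
    fix x
    have "F (T x) \<le> ennreal D * (ennreal (\<rho> x) * F (T x))" if "x \<in> \<Omega>"
    proof -
      have "1 \<le> D * \<rho> x" using D that by (simp add: field_simps)
      then have "1 \<le> ennreal D * ennreal (\<rho> x)" using D by (simp flip: ennreal_mult' add: ennreal_1[symmetric] del: ennreal_1)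
      from mult_right_mono[OF this, of "F (T x)"] show ?thesis by (simp add: mult.assoc)
    qed
    then show "F (T x) * indicator \<Omega> x \<le> ennreal D * (ennreal (\<rho> x) * F (T x) * indicator \<Omega> x)"
      by (auto split: split_indicator)
  qed
qed

lemma transport_double_sum_bounds:
  fixes \<Omega> V :: "'a::euclidean_space set" and k :: "'a \<Rightarrow> 'a \<Rightarrow> real"
  assumes transport: "open \<Omega>" "finite V" "T \<in> restrict_space borel \<Omega> \<rightarrow>\<^sub>M restrict_space borel V"
      "distr (density (restrict_space lborel \<Omega>) (\<lambda>x. ennreal (\<rho> x))) (restrict_space borel V) T = \<nu>"
      "prob_space \<nu>" "continuous_on \<Omega> \<rho>" "D > 0" "\<And>x. x \<in> \<Omega> \<Longrightarrow> 1 / D \<le> \<rho> x \<and> \<rho> x \<le> D"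
    and k: "\<And>x y. 0 \<le> k x y"
  defines "S \<equiv> \<Sum>x\<in>V. \<Sum>y\<in>V. k x y * measure \<nu> {x} * measure \<nu> {y}"
    and "J \<equiv> \<integral>\<^sup>+x. (\<integral>\<^sup>+y. ennreal (k (T x) (T y)) * indicator \<Omega> y \<partial>lborel) * indicator \<Omega> x \<partial>lborel"
  shows "ennreal S \<le> ennreal (D * D) * J" and "J \<le> ennreal (D * D) * ennreal S"
proof -
  note bounds = transport_sum_bounds[OF transport]
  let ?s = "\<lambda>x. \<Sum>y\<in>V. ennreal (k x y) * ennreal (measure \<nu> {y})"
  let ?j = "\<lambda>x. \<integral>\<^sup>+y. ennreal (k x (T y)) * indicator \<Omega> y \<partial>lborel"
  have S: "ennreal S = (\<Sum>x\<in>V. ?s x * ennreal (measure \<nu> {x}))"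
  proof -
    have "S = (\<Sum>x\<in>V. (\<Sum>y\<in>V. k x y * measure \<nu> {y}) * measure \<nu> {x})"
      unfolding S_def sum_distrib_right by (intro sum.cong refl) (simp add: mult_ac)
    then show ?thesis by (simp add: k sum_nonneg flip: ennreal_mult)
  qed
  have "ennreal S \<le> (\<Sum>x\<in>V. (ennreal D * ?j x) * ennreal (measure \<nu> {x}))"
    unfolding S by (intro sum_mono mult_right_mono bounds(1)) auto
  also have "\<dots> = ennreal D * (\<Sum>x\<in>V. ?j x * ennreal (measure \<nu> {x}))"
    by (simp add: sum_distrib_left mult.assoc)
  also have "\<dots> \<le> ennreal D * (ennreal D * J)"
    unfolding J_def by (intro mult_left_mono bounds(1)) auto
  finally show "ennreal S \<le> ennreal (D * D) * J"
    using \<open>D > 0\<close> by (simp add: ennreal_mult mult.assoc)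
  have "J \<le> ennreal D * (\<Sum>x\<in>V. ?j x * ennreal (measure \<nu> {x}))"
    unfolding J_def by (rule bounds(2))
  also have "\<dots> \<le> ennreal D * (\<Sum>x\<in>V. (ennreal D * ?s x) * ennreal (measure \<nu> {x}))"
    by (intro mult_left_mono sum_mono mult_right_mono bounds(2)) auto
  also have "\<dots> = ennreal D * (ennreal D * ennreal S)"
    unfolding S by (simp only: mult.assoc sum_distrib_left[symmetric])
  finally show "J \<le> ennreal (D * D) * ennreal S"
    using \<open>D > 0\<close> by (simp add: ennreal_mult mult.assoc)
qed

text \<open>
  The domain inequality is applied to \<open>u \<circ> T\<close>. Since \<open>T\<close> moves points by at most \<open>\<tau>\<close>, points at
  distance at most \<open>\<delta>\<close> have images at distance at most \<open>\<delta> + 2 \<tau>\<close>, so only pairs of vertices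
  within \<open>r\<close> of each other enter on the right.
\<close>

lemma graph_poincare_of_nonlocal:
  fixes \<Omega> V :: "'a::euclidean_space set" and u :: "'a \<Rightarrow> real"
  assumes transport: "open \<Omega>" "finite V" "T \<in> restrict_space borel \<Omega> \<rightarrow>\<^sub>M restrict_space borel V"
      "distr (density (restrict_space lborel \<Omega>) (\<lambda>x. ennreal (\<rho> x))) (restrict_space borel V) T = \<nu>"
      "prob_space \<nu>" "continuous_on \<Omega> \<rho>" "D > 0" "\<And>x. x \<in> \<Omega> \<Longrightarrow> 1 / D \<le> \<rho> x \<and> \<rho> x \<le> D"
    and close: "\<And>x. x \<in> \<Omega> \<Longrightarrow> norm (T x - x) \<le> \<tau>" and "\<delta> + 2 * \<tau> \<le> r" and "C \<ge> 0"
    and poincare: "\<And>f. f \<in> borel_measurable borel \<Longrightarrow>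
      nonlocal_energy p f \<Omega> UNIV \<le> ennreal C * nonlocal_energy p f \<Omega> (cball 0 \<delta>)"
  shows "(\<Sum>x\<in>V. \<Sum>y\<in>V. \<bar>u x - u y\<bar> powr p * measure \<nu> {x} * measure \<nu> {y}) \<le>
    D ^ 4 * C * (\<Sum>x\<in>V. \<Sum>y\<in>V. of_bool (norm (x - y) \<le> r) * \<bar>u x - u y\<bar> powr p *
      measure \<nu> {x} * measure \<nu> {y})" (is "?S \<le> _ * ?N")
proof -
  \<comment> \<open>Any Borel extension of \<open>u \<circ> T\<close> works: the energies only see points of \<open>\<Omega>\<close>.\<close>
  define f where "f x = (if x \<in> \<Omega> then u (T x) else 0)" for x
  have "u \<in> borel_measurable (restrict_space borel V)"
  proof (rule measurableI)
    fix A :: "real set"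
    have "finite (u -` A \<inter> V)" using \<open>finite V\<close> by simp
    then have "u -` A \<inter> V \<in> sets borel" by (intro borel_closed finite_imp_closed)
    then show "u -` A \<inter> space (restrict_space borel V) \<in> sets (restrict_space borel V)"
      by (auto simp: space_restrict_space sets_restrict_space intro: image_eqI[of _ _ "u -` A \<inter> V"])
  qed auto
  from measurable_compose[OF transport(3) this]
  have f: "f \<in> borel_measurable borel"
    unfolding f_def using \<open>open \<Omega>\<close> by (subst measurable_If_restrict_space_iff) auto
  let ?near = "\<lambda>x y. of_bool (norm (x - y) \<le> r) * \<bar>u x - u y\<bar> powr p"
  note all_bound = transport_double_sum_bounds(1)[OF transport, of "\<lambda>x y. \<bar>u x - u y\<bar> powr p"]
  note near_bound = transport_double_sum_bounds(2)[OF transport, of ?near]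
  have "ennreal ?S \<le> ennreal (D * D) * nonlocal_energy p f \<Omega> UNIV"
  proof -
    have "(\<integral>\<^sup>+x. (\<integral>\<^sup>+y. ennreal (\<bar>u (T x) - u (T y)\<bar> powr p) * indicator \<Omega> y \<partial>lborel) * indicator \<Omega> x \<partial>lborel)
        = nonlocal_energy p f \<Omega> UNIV"
      unfolding nonlocal_energy_def
      by (intro nn_integral_cong) (auto simp: f_def split: split_indicator intro!: nn_integral_cong)
    with all_bound show ?thesis by simp
  qed
  also have "\<dots> \<le> ennreal (D * D) * (ennreal C * nonlocal_energy p f \<Omega> (cball 0 \<delta>))"
    by (intro mult_left_mono poincare f) auto
  also have "\<dots> \<le> ennreal (D * D) * (ennreal C * (ennreal (D * D) * ennreal ?N))"
  proof (intro mult_left_mono)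
    have moved: "norm (T x - T y) \<le> r" if "x \<in> \<Omega>" "y \<in> \<Omega>" "norm (y - x) \<le> \<delta>" for x y
    proof -
      have "norm (T x - T y) = norm ((T x - x) - (T y - y) - (y - x))" by (simp add: algebra_simps)
      also have "\<dots> \<le> norm (T x - x) + norm (T y - y) + norm (y - x)"
        using norm_triangle_ineq4[of "(T x - x) - (T y - y)" "y - x"] norm_triangle_ineq4[of "T x - x" "T y - y"]
        by linarith
      also have "\<dots> \<le> r" using close[OF that(1)] close[OF that(2)] that(3) assms(10) by linarith
      finally show ?thesis .
    qed
    have "nonlocal_energy p f \<Omega> (cball 0 \<delta>) \<le>
        (\<integral>\<^sup>+x. (\<integral>\<^sup>+y. ennreal (?near (T x) (T y)) * indicator \<Omega> y \<partial>lborel) * indicator \<Omega> x \<partial>lborel)"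
      unfolding nonlocal_energy_def
    proof (rule nn_integral_mono)
      fix x
      show "(\<integral>\<^sup>+y. ennreal (\<bar>f x - f y\<bar> powr p) * indicator \<Omega> x * indicator \<Omega> y * indicator (cball 0 \<delta>) (y - x) \<partial>lborel)
        \<le> (\<integral>\<^sup>+y. ennreal (?near (T x) (T y)) * indicator \<Omega> y \<partial>lborel) * indicator \<Omega> x"
      proof (cases "x \<in> \<Omega>")
        case True
        then show ?thesis
          using moved[of x] by (auto simp: f_def split: split_indicator intro!: nn_integral_mono)
      qed simp
    qed
    also have "\<dots> \<le> ennreal (D * D) * ennreal ?N"
      using near_bound by simp
    finally show "nonlocal_energy p f \<Omega> (cball 0 \<delta>) \<le> ennreal (D * D) * ennreal ?N" .
  qed auto
  also have "\<dots> = ennreal (D ^ 4 * C * ?N)"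
    using \<open>C \<ge> 0\<close> \<open>D > 0\<close>
    by (simp add: ennreal_mult[symmetric] sum_nonneg power4_eq_xxxx mult_ac)
  finally show ?thesis
    using \<open>C \<ge> 0\<close> \<open>D > 0\<close> by (subst (asm) ennreal_le_iff) (auto intro!: mult_nonneg_nonneg sum_nonneg)
qed

lemma sum_deviation_from_mean_le:
  fixes u w :: "'b \<Rightarrow> real"
  assumes "p \<ge> 1" "finite V" "\<And>x. x \<in> V \<Longrightarrow> 0 \<le> w x" and w: "(\<Sum>x\<in>V. w x) = 1"
  shows "(\<Sum>x\<in>V. \<bar>u x - (\<Sum>y\<in>V. u y * w y)\<bar> powr p * w x) \<le>
    (\<Sum>x\<in>V. \<Sum>y\<in>V. \<bar>u x - u y\<bar> powr p * w x * w y)"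
proof (rule sum_mono)
  fix x assume "x \<in> V"
  have "u x - (\<Sum>y\<in>V. u y * w y) = (\<Sum>y\<in>V. w y * (u x - u y))"
    using w by (simp add: right_diff_distrib sum_subtractf mult.commute flip: sum_distrib_left)
  also have "\<bar>\<dots>\<bar> \<le> (\<Sum>y\<in>V. w y * \<bar>u x - u y\<bar>)"
    using assms(3) by (intro order_trans[OF sum_abs] sum_mono) (simp add: abs_mult)
  finally have "\<bar>u x - (\<Sum>y\<in>V. u y * w y)\<bar> powr p \<le> (\<Sum>y\<in>V. w y * \<bar>u x - u y\<bar>) powr p"
    using \<open>p \<ge> 1\<close> by (intro powr_mono2) auto
  also have "\<dots> \<le> (\<Sum>y\<in>V. w y * \<bar>u x - u y\<bar> powr p)"
    using assms by (intro powr_jensen_sum) auto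
  finally have "\<bar>u x - (\<Sum>y\<in>V. u y * w y)\<bar> powr p * w x \<le> (\<Sum>y\<in>V. w y * \<bar>u x - u y\<bar> powr p) * w x"
    using assms(3)[OF \<open>x \<in> V\<close>] by (rule mult_right_mono)
  then show "\<bar>u x - (\<Sum>y\<in>V. u y * w y)\<bar> powr p * w x \<le> (\<Sum>y\<in>V. \<bar>u x - u y\<bar> powr p * w x * w y)"
    by (simp add: sum_distrib_left sum_distrib_right mult_ac)
qed

text \<open>
  On pairs at distance at most \<open>\<epsilon> / b\<close> the kernel is at least \<open>a\<close>; the power of \<open>\<epsilon>\<close> undoes the
  two normalisations of the energy.
\<close>

lemma near_sum_le_graph_energy:
  fixes V :: "(real^'d) set"
  assumes "\<epsilon> > 0" "b > 0" "a > 0"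
    and kernel: "\<And>r. r \<ge> 0 \<Longrightarrow> a * of_bool (b * r \<le> 1) \<le> \<eta> r"
  shows "(\<Sum>x\<in>V. \<Sum>y\<in>V. of_bool (norm (x - y) \<le> \<epsilon> / b) * \<bar>u x - u y\<bar> powr p *
      measure \<nu> {x} * measure \<nu> {y})
    \<le> \<epsilon> powr (p + real CARD('d)) / a * graph_energy p \<eta> \<epsilon> V \<nu> u"
proof -
  have "of_bool (norm (x - y) \<le> \<epsilon> / b) * \<bar>u x - u y\<bar> powr p * measure \<nu> {x} * measure \<nu> {y} \<le>
      \<epsilon> ^ CARD('d) / a * (scaled_kernel CARD('d) \<eta> \<epsilon> (norm (x - y)) * \<bar>u x - u y\<bar> powr p *
      measure \<nu> {x} * measure \<nu> {y})" for x y :: "real^'d"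
  proof -
    have "of_bool (norm (x - y) \<le> \<epsilon> / b) \<le> \<eta> (norm (x - y) / \<epsilon>) / a"
      using kernel[of "norm (x - y) / \<epsilon>"] assms(1-3) by (auto simp: field_simps split: if_splits)
    also have "\<dots> = \<epsilon> ^ CARD('d) / a * scaled_kernel CARD('d) \<eta> \<epsilon> (norm (x - y))"
      using \<open>\<epsilon> > 0\<close> by (simp add: scaled_kernel_def)
    finally have "of_bool (norm (x - y) \<le> \<epsilon> / b) * (\<bar>u x - u y\<bar> powr p * measure \<nu> {x} * measure \<nu> {y}) \<le>
        \<epsilon> ^ CARD('d) / a * scaled_kernel CARD('d) \<eta> \<epsilon> (norm (x - y)) *
        (\<bar>u x - u y\<bar> powr p * measure \<nu> {x} * measure \<nu> {y})"
      by (rule mult_right_mono) simp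
    then show ?thesis by (simp only: mult.assoc)
  qed
  then have "(\<Sum>x\<in>V. \<Sum>y\<in>V. of_bool (norm (x - y) \<le> \<epsilon> / b) * \<bar>u x - u y\<bar> powr p *
      measure \<nu> {x} * measure \<nu> {y}) \<le>
      (\<Sum>x\<in>V. \<Sum>y\<in>V. \<epsilon> ^ CARD('d) / a * (scaled_kernel CARD('d) \<eta> \<epsilon> (norm (x - y)) *
        \<bar>u x - u y\<bar> powr p * measure \<nu> {x} * measure \<nu> {y}))"
    by (intro sum_mono)
  also have "\<dots> = \<epsilon> powr (p + real CARD('d)) / a * graph_energy p \<eta> \<epsilon> V \<nu> u"
    using \<open>\<epsilon> > 0\<close> unfolding graph_energy_def sum_distrib_left[symmetric]
    by (simp add: powr_add powr_realpow)
  finally show ?thesis .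
qed

section \<open>The Poincare inequality on the graphs\<close>

theorem theorem5p9:
  fixes \<Omega> :: "(real^'d) set"
    and \<mu> :: "(real^'d) measure" and \<rho> :: "real^'d \<Rightarrow> real"
    and V :: "nat \<Rightarrow> (real^'d) set" and \<mu>n :: "nat \<Rightarrow> (real^'d) measure"
    and \<epsilon> :: "nat \<Rightarrow> real" and \<eta> :: "real \<Rightarrow> real"
    and T :: "nat \<Rightarrow> real^'d \<Rightarrow> real^'d"
    and p q K H D :: real
  assumes "open \<Omega>" and "bounded \<Omega>" and "lipschitz_boundary \<Omega>"
    and "connected \<Omega>"
    and "continuous_on \<Omega> \<rho>"
    and "\<mu> = density (restrict_space lborel \<Omega>) (\<lambda>x. ennreal (\<rho> x))"
    and "prob_space \<mu>"
    and "\<And>n. n \<ge> 1 \<Longrightarrow> finite (V n)"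
    and "\<And>n. n \<ge> 1 \<Longrightarrow> V n \<subseteq> \<Omega>"
    and "\<And>n. n \<ge> 1 \<Longrightarrow> sets (\<mu>n n) = sets (restrict_space borel (V n))"
    and "\<And>n. n \<ge> 1 \<Longrightarrow> prob_space (\<mu>n n)"
    and "\<And>n. n \<ge> 1 \<Longrightarrow> \<epsilon> n > 0"
    and "\<epsilon> \<longlonglongrightarrow> 0"
    and "\<And>r. r \<ge> 0 \<Longrightarrow> \<eta> r \<ge> 0"
    and "p \<ge> 1"
    (* (i) *)
    and "kernel_constant \<eta> H" and "0 < K" and "K \<le> H"
    and "\<And>n. n \<ge> 1 \<Longrightarrow> T n \<in> restrict_space borel \<Omega> \<rightarrow>\<^sub>M restrict_space borel (V n)"
    and "\<And>n. n \<ge> 1 \<Longrightarrow> distr \<mu> (restrict_space borel (V n)) (T n) = \<mu>n n"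
    and "\<And>n x. n \<ge> 1 \<Longrightarrow> x \<in> \<Omega> \<Longrightarrow> norm (T n x - x) \<le> K * \<epsilon> n"
    (* (ii) *)
    and "continuous (at 0 within {0..}) \<eta>" and "antimono_on {0..} \<eta>" and "\<eta> 0 > 0"
    (* (iii) *)
    and "D > 0" and "\<And>x. x \<in> \<Omega> \<Longrightarrow> 1 / D \<le> \<rho> x \<and> \<rho> x \<le> D"
    and "q > p" and "kernel_moment CARD('d) \<eta> q < \<infinity>"
  shows "\<exists>C>0. \<forall>n\<ge>1. \<forall>u :: real^'d \<Rightarrow> real.
           graph_Lp_norm p (V n) (\<mu>n n) (\<lambda>x. u x - graph_mean (V n) (\<mu>n n) u)
             \<le> C * graph_energy p \<eta> (\<epsilon> n) (V n) (\<mu>n n) u powr (1 / p)"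
proof -
  note V_fin = assms(8) and \<nu>_sets = assms(10) and \<nu>_prob = assms(11) and \<epsilon>_pos = assms(12)
    and \<epsilon>_lim = assms(13) and \<eta>_nonneg = assms(14) and T_meas = assms(19) and T_push = assms(20)
    and T_close = assms(21) and \<rho>_bounds = assms(26)
  obtain a b where ab: "a > 0" "b \<ge> 1" "H = 1 / (4 * b)"
    and kernel: "\<And>r. r \<ge> 0 \<Longrightarrow> a * of_bool (b * r \<le> 1) \<le> \<eta> r"
    using \<open>kernel_constant \<eta> H\<close> unfolding kernel_constant_def by blast
  have "\<Omega> \<noteq> {}"
  proof
    assume "\<Omega> = {}"
    then have "space \<mu> = {}" using assms(6) by (simp add: space_restrict_space)
    then show False using prob_space.not_empty[OF \<open>prob_space \<mu>\<close>] by simp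
  qed
  then have "nonlocal_poincare p \<Omega>"
    using assms(1-4) \<open>p \<ge> 1\<close> by (intro nonlocal_poincare_lipschitz_domain)
  then obtain c where c: "c \<ge> 0" "\<And>\<delta> f. 0 < \<delta> \<Longrightarrow> \<delta> \<le> 1 \<Longrightarrow> f \<in> borel_measurable borel \<Longrightarrow>
      nonlocal_energy p f \<Omega> UNIV
        \<le> ennreal (c * \<delta> powr - (p + real CARD('d))) * nonlocal_energy p f \<Omega> (cball 0 \<delta>)"
    using nonlocal_poincareE[of p \<Omega>] by (metis DIM_cart DIM_real mult.right_neutral)
  let ?s = "p + real CARD('d)"
  obtain E where E: "\<And>n. \<epsilon> n \<le> E"
    using convergent_imp_bounded[OF \<epsilon>_lim] by (auto simp: bounded_iff abs_le_iff)
  \<comment> \<open>Dividing all \<open>\<epsilon> n\<close> by the same \<open>M\<close> gives jump lengths \<open>\<delta> \<le> 1\<close> with \<open>\<delta> \<le> \<epsilon> n / (2 b)\<close>, while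
      the quotient \<open>\<epsilon> n / \<delta> = M\<close> enters the final constant.\<close>
  define M where "M = max E (2 * b)"
  have M: "M > 0" "2 * b \<le> M" "\<And>n. \<epsilon> n \<le> M"
    using ab E by (auto simp: M_def le_max_iff_disj less_max_iff_disj)
  define C where "C = D ^ 4 * (c * M powr ?s) / a"
  have C: "C \<ge> 0" using \<open>D > 0\<close> c ab by (simp add: C_def)
  \<comment> \<open>Adding 1 makes the constant positive even if \<open>C = 0\<close>.\<close>
  show ?thesis
  proof (intro exI[of _ "(C + 1) powr (1 / p)"] conjI allI impI)
    show "(C + 1) powr (1 / p) > 0" using C by simp
    fix n :: nat and u :: "real^'d \<Rightarrow> real"
    assume n: "n \<ge> 1"
    let ?w = "\<lambda>x. measure (\<mu>n n) {x}"
    let ?GE = "graph_energy p \<eta> (\<epsilon> n) (V n) (\<mu>n n) u"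
    have eps: "\<epsilon> n > 0" using \<epsilon>_pos[OF n] .
    have GE: "?GE \<ge> 0"
      unfolding graph_energy_def scaled_kernel_def using eps \<eta>_nonneg
      by (intro mult_nonneg_nonneg sum_nonneg divide_nonneg_nonneg) auto
    define \<delta> where "\<delta> = \<epsilon> n / M"
    have \<delta>: "0 < \<delta>" "\<delta> \<le> 1" "\<delta> \<le> \<epsilon> n / (2 * b)"
      using eps M ab by (auto simp: \<delta>_def intro!: divide_left_mono)
    have K: "K * \<epsilon> n \<le> \<epsilon> n / (4 * b)"
      using mult_right_mono[OF \<open>K \<le> H\<close>, of "\<epsilon> n"] eps ab by simp
    have w_sum: "(\<Sum>x\<in>V n. ?w x) = 1"
    proof -
      interpret prob_space "\<mu>n n" using \<nu>_prob[OF n] .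
      have sp: "space (\<mu>n n) = V n"
        using sets_eq_imp_space_eq[OF \<nu>_sets[OF n]] by (simp add: space_restrict_space)
      have "{x} \<in> sets (\<mu>n n)" if "x \<in> V n" for x
        unfolding \<nu>_sets[OF n] sets_restrict_space
        using that by (intro image_eqI[of _ _ "{x}"]) auto
      then have "(\<Sum>x\<in>V n. ?w x) = measure (\<mu>n n) (V n)"
        using V_fin[OF n] by (intro finite_measure_eq_sum_singleton[symmetric])
      then show ?thesis using prob_space by (simp add: sp)
    qed
    have "(\<Sum>x\<in>V n. \<bar>u x - graph_mean (V n) (\<mu>n n) u\<bar> powr p * ?w x) \<le>
        (\<Sum>x\<in>V n. \<Sum>y\<in>V n. \<bar>u x - u y\<bar> powr p * ?w x * ?w y)"
      unfolding graph_mean_def using V_fin[OF n] w_sum \<open>p \<ge> 1\<close>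
      by (intro sum_deviation_from_mean_le) auto
    also have "\<dots> \<le> D ^ 4 * (c * \<delta> powr - ?s) *
        (\<Sum>x\<in>V n. \<Sum>y\<in>V n. of_bool (norm (x - y) \<le> \<epsilon> n / b) * \<bar>u x - u y\<bar> powr p * ?w x * ?w y)"
    proof (rule graph_poincare_of_nonlocal[OF \<open>open \<Omega>\<close> V_fin[OF n] T_meas[OF n]
          T_push[OF n, unfolded assms(6)] \<nu>_prob[OF n] \<open>continuous_on \<Omega> \<rho>\<close> \<open>D > 0\<close> \<rho>_bounds T_close[OF n]])
      \<comment> \<open>\<open>T n\<close> uses up the other half of the radius \<open>\<epsilon> n / b\<close>, since \<open>K \<le> 1 / (4 b)\<close>.\<close>
      show "\<delta> + 2 * (K * \<epsilon> n) \<le> \<epsilon> n / b" using \<delta>(3) K by simp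
      show "0 \<le> c * \<delta> powr - ?s" using c(1) by simp
    qed (use \<delta> c in auto)
    also have "\<dots> \<le> D ^ 4 * (c * \<delta> powr - ?s) * (\<epsilon> n powr ?s / a * ?GE)"
      using near_sum_le_graph_energy[OF eps _ \<open>a > 0\<close> kernel] ab c(1)
      by (intro mult_left_mono) auto
    also have "\<dots> = C * ?GE"
      unfolding powr_minus_divide C_def \<delta>_def using eps M by (simp add: powr_divide)
    also have "\<dots> \<le> (C + 1) * ?GE" using GE by (intro mult_right_mono) auto
    finally have "(\<Sum>x\<in>V n. \<bar>u x - graph_mean (V n) (\<mu>n n) u\<bar> powr p * ?w x) \<le> (C + 1) * ?GE" .
    then have "graph_Lp_norm p (V n) (\<mu>n n) (\<lambda>x. u x - graph_mean (V n) (\<mu>n n) u) \<le>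
        ((C + 1) * ?GE) powr (1 / p)"
      unfolding graph_Lp_norm_def using \<open>p \<ge> 1\<close> by (intro powr_mono2 sum_nonneg) auto
    also have "\<dots> = (C + 1) powr (1 / p) * ?GE powr (1 / p)"
      using C GE by (intro powr_mult)
    finally show "graph_Lp_norm p (V n) (\<mu>n n) (\<lambda>x. u x - graph_mean (V n) (\<mu>n n) u) \<le>
        (C + 1) powr (1 / p) * ?GE powr (1 / p)" .
  qed
qed

end
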